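(* Let $k$ be any field, let $G$ be a (finite) forest, let $Q$ be the standard graded polynomial ring over $k$ whose variables are the vertices of $G$, let $I_G\subseteq Q$ be the edge ideal of $G$, and let $R=Q/I_G$. Then the Koszul homology algebra $H(R)$ is generated as a $k$-algebra by $\bigoplus_i H_i(R)_{i+1}$.
   Context: A tree is a simple graph (no loops, no multiple edges) that is connected and contains no cycle; a forest is a disjoint union of trees. The edge ideal of a simple graph $G$ on vertices $x_1,\dots,x_n$ is the ideal $I_G=(x_ix_j \mid x_ix_j \text{ is an edge of } G)$ of $Q=k[x_1,\dots,x_n]$. $H(R)$ denotes the homology of the Koszul complex $K(x_1,\dots,x_n;R)$ on (the images in $R$ of) all the variables of $Q$, i.e. the exterior algebra over $R$ on generators $dx_1,\dots,dx_n$ with differential determined by $dx_i\mapsto x_i$; it is a differential graded algebra, so $H(R)$ is a $k$-algebra. It is bigraded, $H(R)=\bigoplus_{i,j}H_i(R)_j$, where $i$ is the homological degree and $j$ is the internal degree induced by the grading of $R$ (with each $dx_i$ of homological degree $1$ and internal degree $1$). *)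

theory Defs
  imports
    "HOL-Algebra.QuotRing"
    "HOL-Algebra.Generated_Rings"
    "HOL-Library.Poly_Mapping"
    "Graph_Theory.Graph_Theory"
begin

section \<open>Trees and forests\<close>

text \<open>
  A finite simple graph is a \<^locale>\<open>pair_graph\<close>: a finite, loop-free digraph with symmetric arc
  relation, the edge between \<open>u\<close> and \<open>v\<close> being the two arcs \<open>(u, v)\<close> and \<open>(v, u)\<close>.  The library
  constants \<^const>\<open>forest\<close> and \<^const>\<open>tree\<close> are meant for digraphs: under them the closed walk
  \<open>u, v, u\<close> along one edge already is a cycle.  In a simple graph a cycle has length at least 3.
\<close>

definition simple_cycle :: "'v pair_pre_digraph \<Rightarrow> ('v \<times> 'v) awalk \<Rightarrow> bool" where
  "simple_cycle G p \<longleftrightarrow> pre_digraph.cycle (with_proj G) p \<and> 3 \<le> length p"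

definition tree_graph :: "'v pair_pre_digraph \<Rightarrow> bool" where
  "tree_graph G \<longleftrightarrow> pair_graph G \<and> connected (with_proj G) \<and> \<not> (\<exists>p. simple_cycle G p)"

definition forest_graph :: "'v pair_pre_digraph \<Rightarrow> bool" where
  "forest_graph G \<longleftrightarrow>
     (\<exists>\<T>. (\<forall>T\<in>\<T>. tree_graph T) \<and>
          (\<forall>T\<in>\<T>. \<forall>T'\<in>\<T>. T \<noteq> T' \<longrightarrow> pverts T \<inter> pverts T' = {}) \<and>
          pverts G = (\<Union>T\<in>\<T>. pverts T) \<and> parcs G = (\<Union>T\<in>\<T>. parcs T))"


section \<open>Polynomial rings and edge ideals\<close>

text \<open>
  A monomial is a finitely supported exponent function; the multiplication of
  \<^typ>\<open>('v \<Rightarrow>\<^sub>0 nat) \<Rightarrow>\<^sub>0 'k\<close> is the usual (convolution) product of polynomials.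
\<close>

type_synonym ('v, 'k) mpoly = "('v \<Rightarrow>\<^sub>0 nat) \<Rightarrow>\<^sub>0 'k"

definition mpoly_const :: "'k \<Rightarrow> ('v, 'k::field) mpoly" where
  "mpoly_const c = Poly_Mapping.single 0 c"

definition mpoly_var :: "'v \<Rightarrow> ('v, 'k::field) mpoly" where
  "mpoly_var v = Poly_Mapping.single (Poly_Mapping.single v 1) 1"

definition mpoly_ring :: "'v set \<Rightarrow> ('v, 'k::field) mpoly ring" where
  "mpoly_ring V =
     \<lparr>carrier = {p. \<forall>m\<in>Poly_Mapping.keys p. Poly_Mapping.keys m \<subseteq> V},
      monoid.mult = (\<lambda>p q. p * q), one = 1, ring.zero = 0, add = (\<lambda>p q. p + q)\<rparr>"

definition monom_degree :: "('v \<Rightarrow>\<^sub>0 nat) \<Rightarrow> nat" where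
  "monom_degree m = (\<Sum>v\<in>Poly_Mapping.keys m. Poly_Mapping.lookup m v)"

definition mpoly_part :: "'v set \<Rightarrow> nat \<Rightarrow> ('v, 'k::field) mpoly set" where
  "mpoly_part V d =
     {p \<in> carrier (mpoly_ring V). \<forall>m\<in>Poly_Mapping.keys p. monom_degree m = d}"

definition edge_ideal :: "'v pair_pre_digraph \<Rightarrow> ('v, 'k::field) mpoly set" where
  "edge_ideal G =
     genideal (mpoly_ring (pverts G)) {mpoly_var u * mpoly_var v | u v. (u, v) \<in> parcs G}"

definition edge_ring :: "'v pair_pre_digraph \<Rightarrow> ('v, 'k::field) mpoly set ring" where
  "edge_ring G = mpoly_ring (pverts G) Quot edge_ideal G"

definition edge_ring_class :: "'v pair_pre_digraph \<Rightarrow> ('v, 'k::field) mpoly \<Rightarrow> ('v, 'k) mpoly set"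
  where "edge_ring_class G p = edge_ideal G +>\<^bsub>mpoly_ring (pverts G)\<^esub> p"

definition edge_ring_part :: "'v pair_pre_digraph \<Rightarrow> nat \<Rightarrow> ('v, 'k::field) mpoly set set" where
  "edge_ring_part G d = edge_ring_class G ` mpoly_part (pverts G) d"


section \<open>The Koszul complex and its homology\<close>

text \<open>
  The exterior algebra over \<open>R\<close> on generators \<open>dx\<^sub>v\<close> (\<open>v \<in> V\<close>, \<open>V\<close> finite and linearly ordered) is the
  free module with basis \<open>dx\<^sub>S = dx\<^bsub>s1\<^esub> \<and> \<dots> \<and> dx\<^bsub>sp\<^esub>\<close> for \<open>S = {s1 < \<dots> < sp} \<subseteq> V\<close>, so \<open>\<Sum>\<^sub>S f(S) dx\<^sub>S\<close> is
  represented by the function \<open>f\<close> on \<open>Pow V\<close>.  For disjoint \<open>S\<close>, \<open>T\<close> sorting the factors gives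
  \<open>dx\<^sub>S \<and> dx\<^sub>T = (-1)\<^sup>n dx\<^bsub>S \<union> T\<^esub>\<close> with \<open>n\<close> the number of pairs \<open>s \<in> S\<close>, \<open>t \<in> T\<close> with \<open>t < s\<close>;
  otherwise \<open>dx\<^sub>S \<and> dx\<^sub>T = 0\<close>.
\<close>

definition inversions :: "'v::linorder set \<Rightarrow> 'v set \<Rightarrow> nat" where
  "inversions S T = card {(s, t). s \<in> S \<and> t \<in> T \<and> t < s}"

definition ext_const :: "('r, 'm) ring_scheme \<Rightarrow> 'v set \<Rightarrow> 'r \<Rightarrow> ('v set \<Rightarrow> 'r)" where
  "ext_const R V r = (\<lambda>S\<in>Pow V. if S = {} then r else \<zero>\<^bsub>R\<^esub>)"

definition ext_mult ::
  "('r, 'm) ring_scheme \<Rightarrow> 'v::linorder set \<Rightarrow> ('v set \<Rightarrow> 'r) \<Rightarrow> ('v set \<Rightarrow> 'r) \<Rightarrow> ('v set \<Rightarrow> 'r)"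
  where
  "ext_mult R V f g = (\<lambda>U\<in>Pow V.
     \<Oplus>\<^bsub>R\<^esub>S\<in>Pow U. ((\<ominus>\<^bsub>R\<^esub> \<one>\<^bsub>R\<^esub>) [^]\<^bsub>R\<^esub> inversions S (U - S)) \<otimes>\<^bsub>R\<^esub> (f S \<otimes>\<^bsub>R\<^esub> g (U - S)))"

definition ext_algebra ::
  "('r, 'm) ring_scheme \<Rightarrow> 'v::linorder set \<Rightarrow> ('v set \<Rightarrow> 'r) ring" where
  "ext_algebra R V =
     \<lparr>carrier = Pow V \<rightarrow>\<^sub>E carrier R,
      monoid.mult = ext_mult R V,
      one = ext_const R V \<one>\<^bsub>R\<^esub>,
      ring.zero = (\<lambda>S\<in>Pow V. \<zero>\<^bsub>R\<^esub>),
      add = (\<lambda>f g. \<lambda>S\<in>Pow V. f S \<oplus>\<^bsub>R\<^esub> g S)\<rparr>"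

text \<open>
  The \<open>R\<close>-linear antiderivation with \<open>dx\<^sub>v \<mapsto> x\<^sub>v\<close> sends \<open>dx\<^sub>S\<close> to
  \<open>\<Sum>\<^bsub>v \<in> S\<^esub> (-1)\<^sup>n x\<^sub>v dx\<^bsub>S - {v}\<^esub>\<close>, where \<open>n\<close> is the number of \<open>s \<in> S\<close> with \<open>s < v\<close>.  The formula below is
  the resulting coefficient at \<open>dx\<^sub>U\<close>, collected from the sets \<open>S = U \<union> {v}\<close> with \<open>v \<notin> U\<close>.
\<close>

definition koszul_diff ::
  "('r, 'm) ring_scheme \<Rightarrow> 'v::linorder set \<Rightarrow> ('v \<Rightarrow> 'r) \<Rightarrow> ('v set \<Rightarrow> 'r) \<Rightarrow> ('v set \<Rightarrow> 'r)"
  where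
  "koszul_diff R V x f = (\<lambda>U\<in>Pow V.
     \<Oplus>\<^bsub>R\<^esub>v\<in>V - U. ((\<ominus>\<^bsub>R\<^esub> \<one>\<^bsub>R\<^esub>) [^]\<^bsub>R\<^esub> card {s\<in>U. s < v}) \<otimes>\<^bsub>R\<^esub> (x v \<otimes>\<^bsub>R\<^esub> f (insert v U)))"

definition koszul_cycles ::
  "('r, 'm) ring_scheme \<Rightarrow> 'v::linorder set \<Rightarrow> ('v \<Rightarrow> 'r) \<Rightarrow> ('v set \<Rightarrow> 'r) set" where
  "koszul_cycles R V x =
     {f \<in> carrier (ext_algebra R V). koszul_diff R V x f = \<zero>\<^bsub>ext_algebra R V\<^esub>}"

definition koszul_boundaries ::
  "('r, 'm) ring_scheme \<Rightarrow> 'v::linorder set \<Rightarrow> ('v \<Rightarrow> 'r) \<Rightarrow> ('v set \<Rightarrow> 'r) set" where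
  "koszul_boundaries R V x = koszul_diff R V x ` carrier (ext_algebra R V)"

definition koszul_cycle_ring ::
  "('r, 'm) ring_scheme \<Rightarrow> 'v::linorder set \<Rightarrow> ('v \<Rightarrow> 'r) \<Rightarrow> ('v set \<Rightarrow> 'r) ring" where
  "koszul_cycle_ring R V x = (ext_algebra R V)\<lparr>carrier := koszul_cycles R V x\<rparr>"

definition koszul_homology ::
  "('r, 'm) ring_scheme \<Rightarrow> 'v::linorder set \<Rightarrow> ('v \<Rightarrow> 'r) \<Rightarrow> ('v set \<Rightarrow> 'r) set ring" where
  "koszul_homology R V x = koszul_cycle_ring R V x Quot koszul_boundaries R V x"

definition koszul_class ::
  "('r, 'm) ring_scheme \<Rightarrow> 'v::linorder set \<Rightarrow> ('v \<Rightarrow> 'r) \<Rightarrow> ('v set \<Rightarrow> 'r) \<Rightarrow> ('v set \<Rightarrow> 'r) set"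
  where
  "koszul_class R V x z = koszul_boundaries R V x +>\<^bsub>koszul_cycle_ring R V x\<^esub> z"

text \<open>
  Here \<open>gr d\<close> is the degree \<open>d\<close> part of \<open>R\<close>.  As \<open>dx\<^sub>S\<close> has homological and internal degree
  \<^term>\<open>card S\<close>, an element \<open>r dx\<^sub>S\<close> with \<open>r\<close> in \<open>gr d\<close> has internal degree \<^term>\<open>d + card S\<close>.
\<close>

definition koszul_part ::
  "('r, 'm) ring_scheme \<Rightarrow> (nat \<Rightarrow> 'r set) \<Rightarrow> 'v::linorder set \<Rightarrow> nat \<Rightarrow> nat \<Rightarrow> ('v set \<Rightarrow> 'r) set"
  where
  "koszul_part R gr V i j =
     {f \<in> carrier (ext_algebra R V).
        \<forall>S\<in>Pow V. f S \<noteq> \<zero>\<^bsub>R\<^esub> \<longrightarrow> card S = i \<and> (\<exists>d. f S \<in> gr d \<and> d + card S = j)}"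

definition koszul_homology_part ::
  "('r, 'm) ring_scheme \<Rightarrow> (nat \<Rightarrow> 'r set) \<Rightarrow> 'v::linorder set \<Rightarrow> ('v \<Rightarrow> 'r) \<Rightarrow> nat \<Rightarrow> nat \<Rightarrow>
     ('v set \<Rightarrow> 'r) set set" where
  "koszul_homology_part R gr V x i j =
     koszul_class R V x ` (koszul_cycles R V x \<inter> koszul_part R gr V i j)"


section \<open>Generators of algebras\<close>

definition sum_of_subgroups :: "('a, 'm) ring_scheme \<Rightarrow> ('i \<Rightarrow> 'a set) \<Rightarrow> 'a set" where
  "sum_of_subgroups A M = {\<Oplus>\<^bsub>A\<^esub>i\<in>I. h i | I h. finite I \<and> (\<forall>i\<in>I. h i \<in> M i)}"

text \<open>
  \<open>A\<close> is an algebra over \<^typ>\<open>'k\<close> through the structure map \<open>\<phi>\<close>, so the subalgebra generated by \<open>S\<close>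
  is the least subring containing \<open>S\<close> and the image of \<open>\<phi>\<close>.
\<close>

definition generated_as_algebra ::
  "('k \<Rightarrow> 'a) \<Rightarrow> ('a, 'm) ring_scheme \<Rightarrow> 'a set \<Rightarrow> bool" where
  "generated_as_algebra \<phi> A S \<longleftrightarrow>
     S \<subseteq> carrier A \<and> generate_ring A (range \<phi> \<union> S) = carrier A"


section \<open>Koszul homology of the quotient by an edge ideal\<close>

type_synonym ('v, 'k) edge_homology = "('v set \<Rightarrow> ('v, 'k) mpoly set) set"

definition edge_homology ::
  "'v::linorder pair_pre_digraph \<Rightarrow> ('v, 'k::field) edge_homology ring" where
  "edge_homology G =
     koszul_homology (edge_ring G) (pverts G) (\<lambda>v. edge_ring_class G (mpoly_var v))"

definition edge_homology_part ::
  "'v::linorder pair_pre_digraph \<Rightarrow> nat \<Rightarrow> nat \<Rightarrow> ('v, 'k::field) edge_homology set" where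
  "edge_homology_part G i j =
     koszul_homology_part (edge_ring G) (edge_ring_part G) (pverts G)
       (\<lambda>v. edge_ring_class G (mpoly_var v)) i j"

definition edge_homology_scalar ::
  "'v::linorder pair_pre_digraph \<Rightarrow> 'k::field \<Rightarrow> ('v, 'k) edge_homology" where
  "edge_homology_scalar G c =
     koszul_class (edge_ring G) (pverts G) (\<lambda>v. edge_ring_class G (mpoly_var v))
       (ext_const (edge_ring G) (pverts G) (edge_ring_class G (mpoly_const c)))"

end

(*
  The multidegree a part of the Koszul complex has the basis x^(a-S) dx_S, where S is contained in
  the support P of a and the support of a-S is an independent set of G.  Let z be a cycle of
  multidegree a and v a vertex of P.  Subtracting a boundary, we may assume that dx_v occurs in all
  terms of z.  If a_v >= 2, or if v is isolated in P, the cycle condition then forces z = 0.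
  Otherwise a is squarefree, and v can be chosen with exactly one neighbour u in P because G is a
  forest.  Now the cycle condition forces u to lie in P - S for all terms of z, hence the set N of
  all neighbours of u in P to be contained in S.  So z is the product of x_u dx_N, which is a cycle
  in the linear strand, with a cycle of the smaller squarefree multidegree P - N - {u}, and
  induction applies.

  The computations take place in the Koszul complex of the polynomial ring, with cycles and
  boundaries understood modulo the edge ideal.
*)
theory Submission
  imports Defs
begin

section \<open>Exterior forms over a commutative ring\<close>

text \<open>In a fixed multidegree the Koszul complex of the polynomial ring is the chain complex of
  the full simplex on \<open>P\<close>. Coning from \<open>v\<close> contracts it, which is why
  \<open>dx_v\<close> can be forced into every term. The edge ideal only switches off the cycle
  condition at those sets \<open>U\<close> for which the support of \<open>a - U\<close> contains an
  edge. So a term \<open>S\<close> survives only if putting \<open>v\<close> back into the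
  independent complement of \<open>S\<close> creates an edge, that is, if \<open>v\<close> has a
  neighbour outside \<open>S\<close>. If \<open>u\<close> is its only neighbour, then
  \<open>u\<close> is the same for all surviving terms and one factor splits off from all of them at
  once; with two neighbours the factor could vary with the term.

  The delicate point is that the cofactor is again a cycle. The Leibniz rule only shows that
  \<open>x_u\<close> times its differential lies in the edge ideal, and \<open>x_u\<close> is a zero
  divisor in general. Since \<open>N\<close> consists of all neighbours of \<open>u\<close> in
  \<open>P\<close>, the remaining vertices contain no neighbour of \<open>u\<close>, and there
  \<open>x_u\<close> can be cancelled.

  The forest enters through one consequence: every nonempty set of vertices has a member with at
  most one neighbour in the set.\<close>

definition wedge :: "('v::linorder set \<Rightarrow> 'a::comm_ring_1) \<Rightarrow> ('v set \<Rightarrow> 'a) \<Rightarrow> 'v set \<Rightarrow> 'a" where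
  "wedge f g U = (\<Sum>S\<in>Pow U. (-1) ^ inversions S (U - S) * (f S * g (U - S)))"

text \<open>The parameters serve two uses: with the variables over all vertices this is the Koszul
  differential, and with \<open>x = (\<lambda>_. 1)\<close> over the support of a multidegree it is
  the boundary map of a full simplex, acting on coefficients.\<close>

definition kdiff :: "'v::linorder set \<Rightarrow> ('v \<Rightarrow> 'a::comm_ring_1) \<Rightarrow> ('v set \<Rightarrow> 'a) \<Rightarrow> 'v set \<Rightarrow> 'a" where
  "kdiff V x f U = (\<Sum>v\<in>V - U. (-1) ^ card {s\<in>U. s < v} * (x v * f (insert v U)))"

lemma wedge_add_left: "wedge (\<lambda>S. f S + f' S) g U = wedge f g U + wedge f' g U"
  by (simp add: wedge_def algebra_simps sum.distrib)

lemma wedge_add_right: "wedge f (\<lambda>S. g S + g' S) U = wedge f g U + wedge f g' U"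
  by (simp add: wedge_def algebra_simps sum.distrib)

lemma kdiff_add: "kdiff V x (\<lambda>S. f S + g S) U = kdiff V x f U + kdiff V x g U"
  by (simp add: kdiff_def algebra_simps sum.distrib)

lemma kdiff_uminus: "kdiff V x (\<lambda>S. - f S) U = - kdiff V x f U"
  by (simp add: kdiff_def sum_negf)

lemma card_less_insert:
  assumes "finite U" "w \<notin> U"
  shows "card {s \<in> insert w U. s < v} = card {s \<in> U. s < v} + (if w < v then 1 else 0)"
proof -
  have "{s \<in> insert w U. s < v} = (if w < v then insert w {s \<in> U. s < v} else {s \<in> U. s < v})"
    by auto
  then show ?thesis using assms by simp
qed

text \<open>Every pair \<open>v < w\<close> occurs once in each order of insertion. The presence of
  \<open>v\<close> raises the count for \<open>w\<close> by one, the presence of \<open>w\<close>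
  leaves the count for \<open>v\<close> unchanged, so the two terms have opposite signs.\<close>

lemma kdiff_kdiff:
  fixes V :: "'v::linorder set"
  assumes "finite V" "U \<subseteq> V"
  shows "kdiff V x (kdiff V x f) U = 0"
proof -
  have fU: "finite U" using assms finite_subset by blast
  define t where "t v w = (-1) ^ card {s\<in>U. s < v} * (x v * ((-1) ^ card {s\<in>insert v U. s < w} *
    (x w * f (insert w (insert v U)))))" for v w
  define D1 where "D1 = {(v, w). v \<in> V - U \<and> w \<in> V - U \<and> v < w}"
  define D2 where "D2 = {(v, w). v \<in> V - U \<and> w \<in> V - U \<and> w < v}"
  have fin: "finite D1" "finite D2"
    by (rule finite_subset[of _ "V \<times> V"]; use assms in \<open>auto simp: D1_def D2_def\<close>)+
  have anti: "t w v = - t v w" if "v \<in> V - U" "w \<in> V - U" "v < w" for v w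
  proof -
    have "card {s \<in> insert w U. s < v} = card {s \<in> U. s < v}"
      "card {s \<in> insert v U. s < w} = Suc (card {s \<in> U. s < w})"
      "insert v (insert w U) = insert w (insert v U)"
      using that fU by (auto simp: card_less_insert simp del: insert_iff)
    then show ?thesis unfolding t_def by (simp add: mult_ac del: insert_iff)
  qed
  have "kdiff V x (kdiff V x f) U = (\<Sum>v\<in>V - U. \<Sum>w\<in>V - insert v U. t v w)"
    by (simp add: kdiff_def t_def sum_distrib_left)
  also have "\<dots> = sum (case_prod t) (Sigma (V - U) (\<lambda>v. V - insert v U))"
    using assms by (subst sum.Sigma) auto
  also have "Sigma (V - U) (\<lambda>v. V - insert v U) = D1 \<union> D2"
    by (auto simp: D1_def D2_def)
  also have "sum (case_prod t) (D1 \<union> D2) = sum (case_prod t) D1 + sum (case_prod t) D2"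
    by (rule sum.union_disjoint[OF fin]) (auto simp: D1_def D2_def)
  also have "sum (case_prod t) D2 = (\<Sum>(v, w)\<in>D1. - t v w)"
    by (rule sum.reindex_bij_witness[of _ prod.swap prod.swap])
      (auto simp: D1_def D2_def anti)
  also have "\<dots> = - sum (case_prod t) D1"
    by (simp add: sum_negf split_def)
  finally show ?thesis by simp
qed

lemma inversions_insert_left:
  assumes "finite S" "finite T" "v \<notin> S"
  shows "inversions (insert v S) T = inversions S T + card {t \<in> T. t < v}"
proof -
  have "{(s, t). s \<in> insert v S \<and> t \<in> T \<and> t < s} =
    {(s, t). s \<in> S \<and> t \<in> T \<and> t < s} \<union> Pair v ` {t \<in> T. t < v}" by auto
  moreover have "finite {(s, t). s \<in> S \<and> t \<in> T \<and> t < s}"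
    by (rule finite_subset[of _ "S \<times> T"]) (use assms in auto)
  ultimately show ?thesis unfolding inversions_def using assms
    by (simp, subst card_Un_disjoint) (auto simp: card_image inj_on_def)
qed

lemma inversions_insert_right:
  assumes "finite S" "finite T" "v \<notin> T"
  shows "inversions S (insert v T) = inversions S T + card {s \<in> S. v < s}"
proof -
  have "{(s, t). s \<in> S \<and> t \<in> insert v T \<and> t < s} =
    {(s, t). s \<in> S \<and> t \<in> T \<and> t < s} \<union> (\<lambda>s. (s, v)) ` {s \<in> S. v < s}" by auto
  moreover have "finite {(s, t). s \<in> S \<and> t \<in> T \<and> t < s}"
    by (rule finite_subset[of _ "S \<times> T"]) (use assms in auto)
  ultimately show ?thesis unfolding inversions_def using assms
    by (simp, subst card_Un_disjoint) (auto simp: card_image inj_on_def)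
qed

lemma card_less_plus_card_greater:
  assumes "finite (S :: 'v::linorder set)" "v \<notin> S"
  shows "card {s \<in> S. s < v} + card {s \<in> S. v < s} = card S"
proof -
  have "S = {s \<in> S. s < v} \<union> {s \<in> S. v < s}" using assms(2) by (auto intro: le_neq_trans)
  then have "card S = card ({s \<in> S. s < v} \<union> {s \<in> S. v < s})" by simp
  then show ?thesis using assms by (subst (asm) card_Un_disjoint) auto
qed

lemma card_less_split:
  assumes "finite U" "S \<subseteq> U"
  shows "card {s \<in> U. s < v} = card {s \<in> S. s < v} + card {s \<in> U - S. s < v}"
proof -
  have "{s \<in> U. s < v} = {s \<in> S. s < v} \<union> {s \<in> U - S. s < v}" using assms(2) by auto
  then show ?thesis using assms finite_subset[OF assms(2,1)] by (simp, subst card_Un_disjoint) auto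
qed

lemma minus_one_power_eq: "even (m + n) \<Longrightarrow> (-1) ^ m = ((-1) ^ n :: 'a::comm_ring_1)"
  by (cases "even m"; cases "even n") auto

lemma minus_one_power_eq_neg: "odd (m + n) \<Longrightarrow> (-1) ^ m = (- ((-1) ^ n) :: 'a::comm_ring_1)"
  by (cases "even m"; cases "even n") auto

text \<open>Graded Leibniz rule. Forms may have mixed degree, so the sign of the second summand is
  put into the coefficients of \<open>f\<close>.\<close>

lemma kdiff_wedge:
  fixes V :: "'v::linorder set"
  assumes "finite V" "U \<subseteq> V"
  shows "kdiff V x (wedge f g) U =
    wedge (kdiff V x f) g U + wedge (\<lambda>S. (-1) ^ card S * f S) (kdiff V x g) U"
proof -
  have fU: "finite U" using finite_subset[OF assms(2,1)] .
  have fS: "finite S" if "S \<subseteq> U" for S using finite_subset[OF that fU] .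
  define sg where "sg S = ((-1) ^ inversions S (U - S) :: 'a)" for S
  define e where "e S v = ((-1) ^ card {s\<in>S. s < v} :: 'a)" for S and v :: 'v
  \<comment> \<open>\<open>L v S\<close> is the term in which \<open>v\<close> is added to the index
    of the left factor, \<open>M v S\<close> the one in which it is added to the right. The inner
    sums on the right-hand side also contain vertices of \<open>U\<close>, which is why they are
    split.\<close>
  define L where "L v S = sg S * (e S v * (x v * f (insert v S)) * g (U - S))" for v S
  define M where "M v S = sg S * ((-1) ^ card S * f S * (e (U - S) v * (x v * g (insert v (U - S)))))" for v S
  have L: "wedge (kdiff V x f) g U = (\<Sum>S\<in>Pow U. \<Sum>v\<in>V - U. L v S) + (\<Sum>S\<in>Pow U. \<Sum>v\<in>U - S. L v S)"
  proof -
    have "wedge (kdiff V x f) g U = (\<Sum>S\<in>Pow U. \<Sum>v\<in>V - S. L v S)"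
      by (simp add: wedge_def kdiff_def L_def sg_def e_def sum_distrib_left sum_distrib_right)
    also have "\<dots> = (\<Sum>S\<in>Pow U. (\<Sum>v\<in>V - U. L v S) + (\<Sum>v\<in>U - S. L v S))"
    proof (rule sum.cong[OF refl])
      fix S assume "S \<in> Pow U"
      then have "V - S = (V - U) \<union> (U - S)" using assms by auto
      then show "(\<Sum>v\<in>V - S. L v S) = (\<Sum>v\<in>V - U. L v S) + (\<Sum>v\<in>U - S. L v S)"
        using assms fU by (simp only:, subst sum.union_disjoint) auto
    qed
    finally show ?thesis by (simp add: sum.distrib)
  qed
  have M: "wedge (\<lambda>S. (-1) ^ card S * f S) (kdiff V x g) U =
    (\<Sum>S\<in>Pow U. \<Sum>v\<in>V - U. M v S) + (\<Sum>S\<in>Pow U. \<Sum>v\<in>S. M v S)"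
  proof -
    have "wedge (\<lambda>S. (-1) ^ card S * f S) (kdiff V x g) U = (\<Sum>S\<in>Pow U. \<Sum>v\<in>V - (U - S). M v S)"
      by (simp add: wedge_def kdiff_def M_def sg_def e_def sum_distrib_left sum_distrib_right)
    also have "\<dots> = (\<Sum>S\<in>Pow U. (\<Sum>v\<in>V - U. M v S) + (\<Sum>v\<in>S. M v S))"
    proof (rule sum.cong[OF refl])
      fix S assume "S \<in> Pow U"
      then have "V - (U - S) = (V - U) \<union> S" "S \<subseteq> U" using assms by auto
      then show "(\<Sum>v\<in>V - (U - S). M v S) = (\<Sum>v\<in>V - U. M v S) + (\<Sum>v\<in>S. M v S)"
        using assms fS by (simp only:, subst sum.union_disjoint) auto
    qed
    finally show ?thesis by (simp add: sum.distrib)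
  qed
  \<comment> \<open>The terms with \<open>v \<in> U\<close> have no counterpart on the left-hand side and cancel.\<close>
  have "(\<Sum>S\<in>Pow U. \<Sum>v\<in>S. M v S) = sum (\<lambda>(S, v). M v S) (Sigma (Pow U) (\<lambda>S. S))"
    using fU fS by (subst sum.Sigma) auto
  \<comment> \<open>Moving \<open>v\<close> from the left index set to the right one pairs these
    terms; the product of coefficients is the same, so only the signs have to be compared.\<close>
  also have "\<dots> = sum (\<lambda>(S, v). - L v S) (Sigma (Pow U) (\<lambda>S. U - S))"
  proof (rule sum.reindex_bij_witness[of _ "\<lambda>(S, v). (insert v S, v)" "\<lambda>(S, v). (S - {v}, v)"], goal_cases)
    case (5 p)
    then have "p = (insert (snd p) (fst p - {snd p}), snd p)" "insert (snd p) (fst p - {snd p}) \<subseteq> U"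
      by auto
    then obtain S v where p: "p = (insert v S, v)" "v \<notin> S" "insert v S \<subseteq> U"
      by blast
    then have fin: "finite S" using fS by auto
    define T where "T = U - insert v S"
    have T: "U - S = insert v T" "U - insert v S = T" "v \<notin> T" "finite T"
      using p fU by (auto simp: T_def)
    have "inversions (insert v S) T = inversions S T + card {t \<in> T. t < v}"
      "inversions S (insert v T) = inversions S T + card {s \<in> S. v < s}"
      by (rule inversions_insert_left[OF fin T(4) p(2)], rule inversions_insert_right[OF fin T(4,3)])
    moreover have "card S = card {s \<in> S. s < v} + card {s \<in> S. v < s}"
      "card (insert v S) = Suc (card S)"
      using card_less_plus_card_greater[OF fin p(2)] fin p(2) by simp_all
    \<comment> \<open>Every count occurs twice in the total exponent, except for the extra one in
      the cardinality of \<open>insert v S\<close>; this makes the signs opposite.\<close>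
    ultimately have "inversions (insert v S) T + card (insert v S) + card {s \<in> T. s < v} +
      (inversions S (insert v T) + card {s \<in> S. s < v}) =
      Suc (2 * (inversions S T + card S + card {s \<in> T. s < v}))"
      by (simp only: mult_2 add_Suc add_Suc_right add_ac)
    then have "odd (inversions (insert v S) T + card (insert v S) + card {s \<in> T. s < v} +
      (inversions S (insert v T) + card {s \<in> S. s < v}))"
      by (simp only: even_Suc even_mult_iff) simp
    from minus_one_power_eq_neg[OF this, where ?'a = 'a]
    have "sg (insert v S) * ((-1) ^ card (insert v S) * e T v) = - (sg S * e S v)"
      unfolding sg_def e_def T(1,2) power_add by (simp only: mult.assoc)
    moreover have "M v (insert v S) = sg (insert v S) * ((-1) ^ card (insert v S) * e T v) *
       (x v * f (insert v S) * g (U - S))"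
      unfolding M_def T(1,2) by (simp only: mult_ac)
    ultimately have "M v (insert v S) = - L v S"
      unfolding L_def by (simp only: mult_ac mult_minus_left mult_minus_right)
    then show ?case using p by simp
  qed (auto simp: insert_absorb)
  also have "\<dots> = - (\<Sum>S\<in>Pow U. \<Sum>v\<in>U - S. L v S)"
    using fU by (subst sum.Sigma) (auto simp: sum_negf split_def)
  finally have canc: "(\<Sum>S\<in>Pow U. \<Sum>v\<in>S. M v S) = - (\<Sum>S\<in>Pow U. \<Sum>v\<in>U - S. L v S)" .
  have "kdiff V x (wedge f g) U = (\<Sum>v\<in>V - U. \<Sum>S\<in>Pow U. L v S + M v S)"
    unfolding kdiff_def
  proof (rule sum.cong[OF refl])
    fix v assume v: "v \<in> V - U"
    \<comment> \<open>The subsets of \<open>insert v U\<close> are sorted by whether they contain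
      \<open>v\<close>: those that do give the terms \<open>L\<close>, the others the terms
      \<open>M\<close>.\<close>
    let ?t = "\<lambda>S. e U v * (x v * ((-1) ^ inversions S (insert v U - S) * (f S * g (insert v U - S))))"
    have "(-1) ^ card {s\<in>U. s < v} * (x v * wedge f g (insert v U)) = sum ?t (Pow (insert v U))"
      by (simp add: wedge_def e_def sum_distrib_left)
    also have "\<dots> = sum ?t (Pow U) + sum ?t (insert v ` Pow U)"
      unfolding Pow_insert using fU v by (subst sum.union_disjoint) auto
    also have "sum ?t (insert v ` Pow U) = (\<Sum>S\<in>Pow U. ?t (insert v S))"
      using v by (subst sum.reindex) (auto simp: inj_on_def)
    also have "\<dots> = (\<Sum>S\<in>Pow U. L v S)"
    proof (rule sum.cong[OF refl])
      fix S assume S: "S \<in> Pow U"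
      then have D: "insert v U - insert v S = U - S" and vS: "v \<notin> S" using v by auto
      have "inversions (insert v S) (U - S) = inversions S (U - S) + card {s \<in> U - S. s < v}"
        using S fU fS vS by (intro inversions_insert_left) auto
      moreover have "card {s \<in> U. s < v} = card {s \<in> S. s < v} + card {s \<in> U - S. s < v}"
        using S fU by (intro card_less_split) auto
      ultimately have "card {s \<in> U. s < v} + inversions (insert v S) (U - S) +
        (inversions S (U - S) + card {s \<in> S. s < v}) =
        2 * (inversions S (U - S) + card {s \<in> S. s < v} + card {s \<in> U - S. s < v})" by (simp only: mult_2 add_Suc add_Suc_right add_ac)
      then have "even (card {s \<in> U. s < v} + inversions (insert v S) (U - S) +
        (inversions S (U - S) + card {s \<in> S. s < v}))"
        by (simp only: dvd_triv_left)
      from minus_one_power_eq[OF this, where ?'a = 'a]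
      have "e U v * (-1) ^ inversions (insert v S) (U - S) = sg S * e S v"
        unfolding e_def sg_def power_add .
      moreover have "?t (insert v S) = (e U v * (-1) ^ inversions (insert v S) (U - S)) *
        (x v * f (insert v S) * g (U - S))"
        unfolding D by (simp only: mult_ac)
      ultimately show "?t (insert v S) = L v S" unfolding L_def by (simp only: mult_ac)
    qed
    also have "sum ?t (Pow U) = (\<Sum>S\<in>Pow U. M v S)"
    proof (rule sum.cong[OF refl])
      fix S assume S: "S \<in> Pow U"
      then have D: "insert v U - S = insert v (U - S)" and vS: "v \<notin> S" using v by auto
      have "inversions S (insert v (U - S)) = inversions S (U - S) + card {s \<in> S. v < s}"
        using S fU fS v by (intro inversions_insert_right) auto
      moreover have "card {s \<in> U. s < v} = card {s \<in> S. s < v} + card {s \<in> U - S. s < v}"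
        using S fU by (intro card_less_split) auto
      moreover have "card {s \<in> S. s < v} + card {s \<in> S. v < s} = card S"
        using S fS vS by (intro card_less_plus_card_greater) auto
      ultimately have "card {s \<in> U. s < v} + inversions S (insert v (U - S)) +
        (inversions S (U - S) + (card S + card {s \<in> U - S. s < v})) =
        2 * (inversions S (U - S) + card S + card {s \<in> U - S. s < v})" by (simp only: mult_2 add_Suc add_Suc_right add_ac)
      then have "even (card {s \<in> U. s < v} + inversions S (insert v (U - S)) +
        (inversions S (U - S) + (card S + card {s \<in> U - S. s < v})))"
        by (simp only: dvd_triv_left)
      from minus_one_power_eq[OF this, where ?'a = 'a]
      have "e U v * (-1) ^ inversions S (insert v (U - S)) = sg S * ((-1) ^ card S * e (U - S) v)"
        unfolding e_def sg_def power_add .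
      moreover have "?t S = (e U v * (-1) ^ inversions S (insert v (U - S))) *
        (x v * f S * g (insert v (U - S)))"
        unfolding D by (simp only: mult_ac)
      ultimately show "?t S = M v S" unfolding M_def by (simp only: mult_ac)
    qed
    finally show "(-1) ^ card {s\<in>U. s < v} * (x v * wedge f g (insert v U)) = (\<Sum>S\<in>Pow U. L v S + M v S)"
      by (simp add: sum.distrib add.commute)
  qed
  also have "\<dots> = (\<Sum>S\<in>Pow U. \<Sum>v\<in>V - U. L v S) + (\<Sum>S\<in>Pow U. \<Sum>v\<in>V - U. M v S)"
    by (subst sum.swap) (simp add: sum.distrib)
  finally show ?thesis unfolding L M canc by simp
qed


section \<open>Koszul homology of a quotient ring\<close>

text \<open>A presentation of \<open>R\<close> as a quotient of \<open>Q\<close> by the kernel of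
  \<open>h\<close>. Since \<open>Q\<close> is a subset of a type class ring, representatives can be
  handled with ordinary arithmetic and sums instead of the operations of a record.\<close>

locale koszul_presentation = cring R for R (structure) +
  fixes Q :: "'q::comm_ring_1 set" and h :: "'q \<Rightarrow> 'a" and V :: "'v::linorder set" and x :: "'v \<Rightarrow> 'q"
  assumes finite_V: "finite V"
    and one_Q: "1 \<in> Q"
    and add_Q: "\<And>a b. a \<in> Q \<Longrightarrow> b \<in> Q \<Longrightarrow> a + b \<in> Q"
    and uminus_Q: "\<And>a. a \<in> Q \<Longrightarrow> - a \<in> Q"
    and mult_Q: "\<And>a b. a \<in> Q \<Longrightarrow> b \<in> Q \<Longrightarrow> a * b \<in> Q"
    and x_Q: "\<And>v. v \<in> V \<Longrightarrow> x v \<in> Q"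
    and h_image: "h ` Q = carrier R"
    and h_one: "h 1 = \<one>"
    and h_add: "\<And>a b. a \<in> Q \<Longrightarrow> b \<in> Q \<Longrightarrow> h (a + b) = h a \<oplus>\<^bsub>R\<^esub> h b"
    and h_mult: "\<And>a b. a \<in> Q \<Longrightarrow> b \<in> Q \<Longrightarrow> h (a * b) = h a \<otimes> h b"
begin

definition K :: "'q set" where "K = {a \<in> Q. h a = \<zero>}"

text \<open>Forms are total functions of which only the values on subsets of \<open>V\<close> count.
  The parameter is \<open>Q\<close> for all forms and \<open>K\<close> for those that vanish in
  \<open>R\<close>.\<close>

definition cochains :: "'q set \<Rightarrow> ('v set \<Rightarrow> 'q) set" where
  "cochains A = {f. \<forall>S\<subseteq>V. f S \<in> A}"

definition cycles :: "('v set \<Rightarrow> 'q) set" where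
  "cycles = {f \<in> cochains Q. kdiff V x f \<in> cochains K}"

definition homologous :: "('v set \<Rightarrow> 'q) \<Rightarrow> ('v set \<Rightarrow> 'q) \<Rightarrow> bool" where
  "homologous f g \<longleftrightarrow> (\<exists>b\<in>cochains Q. (\<lambda>S. f S - g S - kdiff V x b S) \<in> cochains K)"

definition proj :: "('v set \<Rightarrow> 'q) \<Rightarrow> 'v set \<Rightarrow> 'a" where
  "proj f = (\<lambda>S\<in>Pow V. h (f S))"

definition cl :: "('v set \<Rightarrow> 'q) \<Rightarrow> ('v set \<Rightarrow> 'a) set" where
  "cl f = koszul_class R V (\<lambda>v. h (x v)) (proj f)"

abbreviation H :: "('v set \<Rightarrow> 'a) set ring" where
  "H \<equiv> koszul_homology R V (\<lambda>v. h (x v))"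

lemma zero_Q: "0 \<in> Q"
  using add_Q[OF one_Q uminus_Q[OF one_Q]] by simp

lemma diff_Q: "a \<in> Q \<Longrightarrow> b \<in> Q \<Longrightarrow> a - b \<in> Q"
  using add_Q[OF _ uminus_Q] by simp

lemma sum_Q: "(\<And>i. i \<in> I \<Longrightarrow> f i \<in> Q) \<Longrightarrow> sum f I \<in> Q"
  by (induction I rule: infinite_finite_induct) (auto simp: zero_Q add_Q)

lemma sign_Q: "(-1) ^ n \<in> Q"
  by (induction n) (auto simp: one_Q uminus_Q)

lemma h_closed: "a \<in> Q \<Longrightarrow> h a \<in> carrier R"
  using h_image by auto

lemma h_zero: "h 0 = \<zero>"
  using h_add[OF zero_Q zero_Q] h_closed[OF zero_Q] by (simp add: local.add.r_cancel_one')

lemma h_uminus: "a \<in> Q \<Longrightarrow> h (- a) = \<ominus> h a"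
  using h_add[of "- a" a] h_closed[of a] h_closed[of "- a"] uminus_Q[of a]
  by (simp add: h_zero minus_equality)

lemma h_sum: "(\<And>i. i \<in> I \<Longrightarrow> f i \<in> Q) \<Longrightarrow> h (sum f I) = (\<Oplus>i\<in>I. h (f i))"
proof (induction I rule: infinite_finite_induct)
  case (insert i I)
  then show ?case by (simp add: h_add sum_Q h_closed Pi_iff)
qed (auto simp: h_zero)

lemma h_sign: "h ((-1) ^ n) = (\<ominus> \<one>) [^] n"
proof (induction n)
  case (Suc n)
  have "h ((-1) ^ Suc n) = h (-1) \<otimes> h ((-1) ^ n)"
    unfolding power_Suc by (intro h_mult sign_Q uminus_Q one_Q)
  then show ?case using Suc by (simp add: h_uminus one_Q h_one m_comm)
qed (simp add: h_one)

lemma K_Q: "a \<in> K \<Longrightarrow> a \<in> Q"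
  by (simp add: K_def)

lemma zero_K: "0 \<in> K"
  by (simp add: K_def zero_Q h_zero)

lemma add_K: "a \<in> K \<Longrightarrow> b \<in> K \<Longrightarrow> a + b \<in> K"
  by (simp add: K_def add_Q h_add)

lemma uminus_K: "a \<in> K \<Longrightarrow> - a \<in> K"
  by (simp add: K_def uminus_Q h_uminus)

lemma diff_K: "a \<in> K \<Longrightarrow> b \<in> K \<Longrightarrow> a - b \<in> K"
  using add_K[OF _ uminus_K] by simp

lemma mult_K: "a \<in> Q \<Longrightarrow> b \<in> K \<Longrightarrow> a * b \<in> K"
  by (simp add: K_def mult_Q h_mult h_closed)

lemma mult_K': "a \<in> K \<Longrightarrow> b \<in> Q \<Longrightarrow> a * b \<in> K"
  using mult_K[of b a] by (simp add: mult.commute)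

lemma sum_K: "(\<And>i. i \<in> I \<Longrightarrow> f i \<in> K) \<Longrightarrow> sum f I \<in> K"
  by (induction I rule: infinite_finite_induct) (auto simp: zero_K add_K)

lemma h_eq_iff: "a \<in> Q \<Longrightarrow> b \<in> Q \<Longrightarrow> h a = h b \<longleftrightarrow> a - b \<in> K"
proof
  assume ab: "a \<in> Q" "b \<in> Q" and "h a = h b"
  then show "a - b \<in> K"
    using h_add[OF ab(1) uminus_Q[OF ab(2)]] by (simp add: K_def diff_Q h_uminus h_closed r_neg)
next
  assume ab: "a \<in> Q" "b \<in> Q" and "a - b \<in> K"
  then show "h a = h b"
    using h_add[of "a - b" b] by (simp add: K_def h_closed)
qed

section \<open>Forms with coefficients in \<open>Q\<close> and in the kernel
  \<open>K\<close>\<close>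

lemma cochains_K: "f \<in> cochains K \<Longrightarrow> f \<in> cochains Q"
  by (auto simp: cochains_def K_Q)

lemma cochains_add: "f \<in> cochains Q \<Longrightarrow> g \<in> cochains Q \<Longrightarrow> (\<lambda>S. f S + g S) \<in> cochains Q"
  "f \<in> cochains K \<Longrightarrow> g \<in> cochains K \<Longrightarrow> (\<lambda>S. f S + g S) \<in> cochains K"
  by (auto simp: cochains_def add_Q add_K)

lemma cochains_diff: "f \<in> cochains Q \<Longrightarrow> g \<in> cochains Q \<Longrightarrow> (\<lambda>S. f S - g S) \<in> cochains Q"
  "f \<in> cochains K \<Longrightarrow> g \<in> cochains K \<Longrightarrow> (\<lambda>S. f S - g S) \<in> cochains K"
  by (auto simp: cochains_def diff_Q diff_K)

lemma cochains_uminus: "f \<in> cochains Q \<Longrightarrow> (\<lambda>S. - f S) \<in> cochains Q"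
  "f \<in> cochains K \<Longrightarrow> (\<lambda>S. - f S) \<in> cochains K"
  by (auto simp: cochains_def uminus_Q uminus_K)

lemma cochains_zero: "(\<lambda>S. 0) \<in> cochains Q" "(\<lambda>S. 0) \<in> cochains K"
  by (auto simp: cochains_def zero_Q zero_K)

lemma cochains_sign: "f \<in> cochains Q \<Longrightarrow> (\<lambda>S. (-1) ^ card S * f S) \<in> cochains Q"
  by (auto simp: cochains_def mult_Q sign_Q)

lemma cochains_kdiff:
  assumes "f \<in> cochains Q" shows "kdiff V x f \<in> cochains Q"
proof -
  have "kdiff V x f U \<in> Q" if "U \<subseteq> V" for U
    unfolding kdiff_def using assms that
    by (intro sum_Q mult_Q sign_Q x_Q) (auto simp: cochains_def)
  then show ?thesis by (simp add: cochains_def)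
qed

lemma cochains_kdiff_K:
  assumes "f \<in> cochains K" shows "kdiff V x f \<in> cochains K"
proof -
  have "kdiff V x f U \<in> K" if "U \<subseteq> V" for U
    unfolding kdiff_def using assms that
    by (intro sum_K mult_K sign_Q x_Q) (auto simp: cochains_def)
  then show ?thesis by (simp add: cochains_def)
qed

lemma cochains_wedge:
  assumes "f \<in> cochains Q" "g \<in> cochains Q" shows "wedge f g \<in> cochains Q"
proof -
  have "wedge f g U \<in> Q" if "U \<subseteq> V" for U
    unfolding wedge_def using assms that
    by (intro sum_Q mult_Q sign_Q) (auto simp: cochains_def subset_iff)
  then show ?thesis by (simp add: cochains_def)
qed

lemma cochains_wedge_K_left:
  assumes "f \<in> cochains K" "g \<in> cochains Q" shows "wedge f g \<in> cochains K"
proof -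
  have "wedge f g U \<in> K" if "U \<subseteq> V" for U
    unfolding wedge_def using assms that
    by (intro sum_K mult_K mult_K' sign_Q) (auto simp: cochains_def subset_iff)
  then show ?thesis by (simp add: cochains_def)
qed

lemma cochains_wedge_K_right:
  assumes "f \<in> cochains Q" "g \<in> cochains K" shows "wedge f g \<in> cochains K"
proof -
  have "wedge f g U \<in> K" if "U \<subseteq> V" for U
    unfolding wedge_def using assms that
    by (intro sum_K mult_K sign_Q) (auto simp: cochains_def subset_iff)
  then show ?thesis by (simp add: cochains_def)
qed

lemma kdiff_kdiff_V: "U \<subseteq> V \<Longrightarrow> kdiff V x (kdiff V x f) U = 0"
  by (rule kdiff_kdiff[OF finite_V])

lemma kdiff_wedge_V: "U \<subseteq> V \<Longrightarrow> kdiff V x (wedge f g) U =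
    wedge (kdiff V x f) g U + wedge (\<lambda>S. (-1) ^ card S * f S) (kdiff V x g) U"
  by (rule kdiff_wedge[OF finite_V])

lemma cochains_cong: "(\<And>S. S \<subseteq> V \<Longrightarrow> f S = g S) \<Longrightarrow> f \<in> cochains A \<longleftrightarrow> g \<in> cochains A"
  by (auto simp: cochains_def)

section \<open>Cycles and homologous forms modulo \<open>K\<close>\<close>

lemma cycles_kdiff: "b \<in> cochains Q \<Longrightarrow> kdiff V x b \<in> cycles"
  unfolding cycles_def by (auto simp: cochains_kdiff) (simp add: cochains_def kdiff_kdiff_V zero_K)

lemma cycles_cochains: "f \<in> cycles \<Longrightarrow> f \<in> cochains Q"
  by (simp add: cycles_def)

lemma cycles_zero: "(\<lambda>S. 0) \<in> cycles"
  using cycles_kdiff[OF cochains_zero(1)] by (simp add: kdiff_def[abs_def])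

lemma cycles_K: "f \<in> cochains K \<Longrightarrow> f \<in> cycles"
  by (simp add: cycles_def cochains_kdiff_K cochains_K)

lemma cycles_add: "f \<in> cycles \<Longrightarrow> g \<in> cycles \<Longrightarrow> (\<lambda>S. f S + g S) \<in> cycles"
  by (simp add: cycles_def kdiff_add[abs_def] cochains_add)

lemma cycles_uminus: "f \<in> cycles \<Longrightarrow> (\<lambda>S. - f S) \<in> cycles"
  by (simp add: cycles_def kdiff_uminus[abs_def] cochains_uminus)

lemma cycles_wedge:
  assumes "f \<in> cycles" "g \<in> cycles" shows "wedge f g \<in> cycles"
proof -
  have fg: "f \<in> cochains Q" "g \<in> cochains Q" "kdiff V x f \<in> cochains K" "kdiff V x g \<in> cochains K"
    using assms by (auto simp: cycles_def)
  have "kdiff V x (wedge f g) \<in> cochains K"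
    using cochains_add(2)[OF cochains_wedge_K_left[OF fg(3,2)]
        cochains_wedge_K_right[OF cochains_sign[OF fg(1)] fg(4)]]
    by (subst cochains_cong[OF kdiff_wedge_V])
  then show ?thesis using fg by (simp add: cycles_def cochains_wedge)
qed

lemma homologous_refl: "homologous f f"
  unfolding homologous_def by (rule bexI[OF _ cochains_zero(1)]) (simp add: kdiff_def cochains_zero)

lemma homologous_sym: "homologous f g \<Longrightarrow> homologous g f"
  unfolding homologous_def
proof (elim bexE)
  fix b assume b: "b \<in> cochains Q" "(\<lambda>S. f S - g S - kdiff V x b S) \<in> cochains K"
  from cochains_uminus(2)[OF b(2)] cochains_uminus(1)[OF b(1)]
  show "\<exists>b\<in>cochains Q. (\<lambda>S. g S - f S - kdiff V x b S) \<in> cochains K"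
    by (intro bexI[of _ "\<lambda>S. - b S"]) (auto simp: kdiff_uminus algebra_simps)
qed

lemma homologous_add:
  assumes "homologous f f'" "homologous g g'"
  shows "homologous (\<lambda>S. f S + g S) (\<lambda>S. f' S + g' S)"
proof -
  from assms obtain b c where b: "b \<in> cochains Q" "(\<lambda>S. f S - f' S - kdiff V x b S) \<in> cochains K"
    and c: "c \<in> cochains Q" "(\<lambda>S. g S - g' S - kdiff V x c S) \<in> cochains K"
    unfolding homologous_def by blast
  from cochains_add(2)[OF b(2) c(2)] cochains_add(1)[OF b(1) c(1)] show ?thesis
    unfolding homologous_def
    by (intro bexI[of _ "\<lambda>S. b S + c S"]) (auto simp: kdiff_add algebra_simps)
qed

lemma homologous_trans:
  assumes "homologous f g" "homologous g k" shows "homologous f k"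
proof -
  from assms obtain b c where b: "b \<in> cochains Q" "(\<lambda>S. f S - g S - kdiff V x b S) \<in> cochains K"
    and c: "c \<in> cochains Q" "(\<lambda>S. g S - k S - kdiff V x c S) \<in> cochains K"
    unfolding homologous_def by blast
  from cochains_add(2)[OF b(2) c(2)] cochains_add(1)[OF b(1) c(1)] show ?thesis
    unfolding homologous_def
    by (intro bexI[of _ "\<lambda>S. b S + c S"]) (auto simp: kdiff_add algebra_simps)
qed

lemma homologous_K: "(\<lambda>S. f S - g S) \<in> cochains K \<Longrightarrow> homologous f g"
  unfolding homologous_def by (intro bexI[OF _ cochains_zero(1)]) (auto simp: kdiff_def)

lemma homologous_cycles:
  assumes "homologous f g" "g \<in> cycles" shows "f \<in> cycles"
proof -
  from assms(1) obtain b where b: "b \<in> cochains Q" "(\<lambda>S. f S - g S - kdiff V x b S) \<in> cochains K"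
    unfolding homologous_def by blast
  from cycles_add[OF cycles_add[OF cycles_K[OF b(2)] cycles_kdiff[OF b(1)]] assms(2)]
  show ?thesis by simp
qed

lemma homologous_wedge_left:
  assumes "homologous f f'" "f' \<in> cycles" "g \<in> cycles"
  shows "homologous (wedge f g) (wedge f' g)"
proof -
  from assms(1) obtain b where b: "b \<in> cochains Q" "(\<lambda>S. f S - f' S - kdiff V x b S) \<in> cochains K"
    unfolding homologous_def by blast
  have g: "g \<in> cochains Q" "kdiff V x g \<in> cochains K" using assms by (auto simp: cycles_def)
  let ?k = "\<lambda>S. f S - f' S - kdiff V x b S"
  have f: "f = (\<lambda>S. f' S + (kdiff V x b S + ?k S))" by auto
  \<comment> \<open>By the Leibniz rule, replacing \<open>f - f'\<close> by \<open>db + k\<close>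
    leaves only \<open>k\<close> times \<open>g\<close> and a multiple of \<open>dg\<close>; both
    have coefficients in \<open>K\<close>, the latter because \<open>g\<close> is a cycle modulo
    \<open>K\<close>.\<close>
  have "wedge f g S - wedge f' g S - kdiff V x (wedge b g) S =
    wedge ?k g S - wedge (\<lambda>S. (-1) ^ card S * b S) (kdiff V x g) S" if "S \<subseteq> V" for S
    unfolding kdiff_wedge_V[OF that]
    by (subst f) (simp only: wedge_add_left, simp)
  moreover have "(\<lambda>S. wedge ?k g S - wedge (\<lambda>S. (-1) ^ card S * b S) (kdiff V x g) S) \<in> cochains K"
    using b g by (intro cochains_diff(2) cochains_wedge_K_left[OF b(2)] cochains_wedge_K_right cochains_sign)
  ultimately have "(\<lambda>S. wedge f g S - wedge f' g S - kdiff V x (wedge b g) S) \<in> cochains K"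
    by (subst cochains_cong) auto
  then show ?thesis unfolding homologous_def using cochains_wedge[OF b(1) g(1)] by blast
qed

text \<open>The differential lowers the degree by one, so it anticommutes with the degree sign.
  Hence twisting by that sign preserves cycles modulo \<open>K\<close>.\<close>

lemma kdiff_sign:
  assumes "U \<subseteq> V"
  shows "kdiff V x (\<lambda>S. (-1) ^ card S * f S) U = - ((-1) ^ card U * kdiff V x f U)"
proof -
  have "finite U" using finite_subset[OF assms finite_V] .
  then show ?thesis
    unfolding kdiff_def sum_distrib_left sum_negf[symmetric]
    by (intro sum.cong refl) (simp add: mult_ac)
qed

lemma homologous_wedge_right:
  assumes "homologous g g'" "g' \<in> cycles" "f \<in> cycles"
  shows "homologous (wedge f g) (wedge f g')"
proof -
  from assms(1) obtain b where b: "b \<in> cochains Q" "(\<lambda>S. g S - g' S - kdiff V x b S) \<in> cochains K"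
    unfolding homologous_def by blast
  have fc: "f \<in> cochains Q" "kdiff V x f \<in> cochains K" using assms by (auto simp: cycles_def)
  let ?k = "\<lambda>S. g S - g' S - kdiff V x b S"
  \<comment> \<open>The bounding form is \<open>wedge ?f b\<close>: the sign of the Leibniz rule
    cancels against the one built into \<open>?f\<close>, which leaves \<open>f\<close> times
    \<open>db\<close>.\<close>
  let ?f = "\<lambda>S. (-1) ^ card S * f S"
  have ff: "(\<lambda>S. (-1) ^ card S * ?f S) = f"
    by (simp add: mult.assoc[symmetric] power_add[symmetric] mult_2[symmetric] fun_eq_iff)
  have g: "g = (\<lambda>S. g' S + (kdiff V x b S + ?k S))" by auto
  have "wedge f g S - wedge f g' S - kdiff V x (wedge ?f b) S =
    wedge f ?k S - wedge (kdiff V x ?f) b S" if "S \<subseteq> V" for S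
    unfolding kdiff_wedge_V[OF that] ff
    by (subst g) (simp only: wedge_add_right, simp)
  moreover have "kdiff V x ?f \<in> cochains K"
    using fc(2) by (auto simp: cochains_def kdiff_sign intro!: uminus_K mult_K sign_Q)
  then have "(\<lambda>S. wedge f ?k S - wedge (kdiff V x ?f) b S) \<in> cochains K"
    using b fc by (intro cochains_diff(2) cochains_wedge_K_left cochains_wedge_K_right[OF _ b(2)])
  ultimately have "(\<lambda>S. wedge f g S - wedge f g' S - kdiff V x (wedge ?f b) S) \<in> cochains K"
    by (subst cochains_cong) auto
  then show ?thesis unfolding homologous_def
    using cochains_wedge[OF cochains_sign[OF fc(1)] b(1)] by blast
qed

lemma homologous_wedge:
  assumes "homologous f f'" "homologous g g'" "f' \<in> cycles" "g' \<in> cycles"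
  shows "homologous (wedge f g) (wedge f' g')"
  using homologous_wedge_left[OF assms(1,3) homologous_cycles[OF assms(2,4)]]
    homologous_wedge_right[OF assms(2,4,3)] by (rule homologous_trans)

section \<open>From representatives to the Koszul complex of \<open>R\<close>\<close>

lemma proj_closed: "f \<in> cochains Q \<Longrightarrow> proj f \<in> carrier (ext_algebra R V)"
  by (auto simp: proj_def ext_algebra_def cochains_def h_closed)

lemma proj_surj:
  assumes "F \<in> carrier (ext_algebra R V)" obtains f where "f \<in> cochains Q" "F = proj f"
proof
  let ?f = "\<lambda>S. inv_into Q h (F S)"
  have F: "F S \<in> h ` Q" if "S \<subseteq> V" for S
    using assms that by (auto simp: ext_algebra_def h_image)
  show "?f \<in> cochains Q" using F inv_into_into[OF F] by (auto simp: cochains_def)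
  have "F S = proj ?f S" for S
    using assms F by (cases "S \<subseteq> V") (auto simp: proj_def ext_algebra_def f_inv_into_f)
  then show "F = proj ?f" ..
qed

lemma proj_eq_iff:
  assumes "f \<in> cochains Q" "g \<in> cochains Q"
  shows "proj f = proj g \<longleftrightarrow> (\<lambda>S. f S - g S) \<in> cochains K"
proof -
  have "proj f = proj g \<longleftrightarrow> (\<forall>S\<subseteq>V. h (f S) = h (g S))"
    by (auto simp: proj_def fun_eq_iff restrict_def)
  also have "\<dots> \<longleftrightarrow> (\<lambda>S. f S - g S) \<in> cochains K"
    using assms by (auto simp: cochains_def h_eq_iff)
  finally show ?thesis .
qed

lemma proj_add:
  assumes "f \<in> cochains Q" "g \<in> cochains Q"
  shows "proj f \<oplus>\<^bsub>ext_algebra R V\<^esub> proj g = proj (\<lambda>S. f S + g S)"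
  using assms by (auto simp: proj_def ext_algebra_def cochains_def h_add intro!: restrict_ext)

lemma proj_zero: "proj (\<lambda>S. 0) = \<zero>\<^bsub>ext_algebra R V\<^esub>"
  by (simp add: proj_def ext_algebra_def h_zero)

lemma koszul_diff_proj:
  assumes "f \<in> cochains Q"
  shows "koszul_diff R V (\<lambda>v. h (x v)) (proj f) = proj (kdiff V x f)"
  unfolding koszul_diff_def proj_def
proof (rule restrict_ext)
  fix U assume U: "U \<in> Pow V"
  have ins: "insert v U \<subseteq> V" if "v \<in> V - U" for v using U that by auto
  then have "h (kdiff V x f U) = (\<Oplus>v\<in>V - U. h ((-1) ^ card {s\<in>U. s < v} * (x v * f (insert v U))))"
    unfolding kdiff_def using assms by (intro h_sum mult_Q sign_Q x_Q) (auto simp: cochains_def)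
  also have "\<dots> = (\<Oplus>v\<in>V - U. (\<ominus> \<one>) [^] card {s\<in>U. s < v} \<otimes> (h (x v) \<otimes> (\<lambda>S\<in>Pow V. h (f S)) (insert v U)))"
    using assms ins
    by (intro finsum_cong')
       (auto simp: cochains_def h_mult h_sign[symmetric] mult_Q sign_Q x_Q h_closed)
  finally show "(\<Oplus>v\<in>V - U. (\<ominus> \<one>) [^] card {s\<in>U. s < v} \<otimes> (h (x v) \<otimes> (\<lambda>S\<in>Pow V. h (f S)) (insert v U))) =
      h (kdiff V x f U)" ..
qed

lemma ext_mult_proj:
  assumes "f \<in> cochains Q" "g \<in> cochains Q"
  shows "proj f \<otimes>\<^bsub>ext_algebra R V\<^esub> proj g = proj (wedge f g)"
proof -
  have "ext_mult R V (proj f) (proj g) = proj (wedge f g)"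
    unfolding ext_mult_def proj_def
  proof (rule restrict_ext)
    fix U assume U: "U \<in> Pow V"
    have ins: "S \<subseteq> V" "U - S \<subseteq> V" if "S \<in> Pow U" for S using U that by auto
    then have "h (wedge f g U) = (\<Oplus>S\<in>Pow U. h ((-1) ^ inversions S (U - S) * (f S * g (U - S))))"
      unfolding wedge_def using assms by (intro h_sum mult_Q sign_Q) (auto simp: cochains_def)
    also have "\<dots> = (\<Oplus>S\<in>Pow U. (\<ominus> \<one>) [^] inversions S (U - S) \<otimes>
       ((\<lambda>S\<in>Pow V. h (f S)) S \<otimes> (\<lambda>S\<in>Pow V. h (g S)) (U - S)))"
      using assms ins
      by (intro finsum_cong')
         (auto simp: cochains_def h_mult h_sign[symmetric] mult_Q sign_Q h_closed)
    finally show "(\<Oplus>S\<in>Pow U. (\<ominus> \<one>) [^] inversions S (U - S) \<otimes>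
       ((\<lambda>S\<in>Pow V. h (f S)) S \<otimes> (\<lambda>S\<in>Pow V. h (g S)) (U - S))) = h (wedge f g U)" ..
  qed
  then show ?thesis by (simp add: ext_algebra_def)
qed

lemma koszul_cycles_eq: "koszul_cycles R V (\<lambda>v. h (x v)) = proj ` cycles"
proof -
  have "proj f \<in> koszul_cycles R V (\<lambda>v. h (x v)) \<longleftrightarrow> f \<in> cycles" if f: "f \<in> cochains Q" for f
    using f proj_eq_iff[OF cochains_kdiff[OF f] cochains_zero(1)]
    by (simp add: koszul_cycles_def proj_closed koszul_diff_proj cycles_def proj_zero)
  moreover have "koszul_cycles R V (\<lambda>v. h (x v)) \<subseteq> proj ` cochains Q"
    by (auto simp: koszul_cycles_def elim!: proj_surj)
  ultimately show ?thesis
    using cycles_cochains by blast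
qed

lemma koszul_boundaries_eq: "koszul_boundaries R V (\<lambda>v. h (x v)) = (\<lambda>b. proj (kdiff V x b)) ` cochains Q"
proof -
  have "carrier (ext_algebra R V) = proj ` cochains Q"
    by (auto simp: proj_closed elim!: proj_surj)
  then show ?thesis
    by (auto simp: koszul_boundaries_def image_image koszul_diff_proj)
qed

text \<open>Describes a coset of boundaries by its representatives, so that equalities and
  operations in the homology ring reduce to statements about \<open>homologous\<close>.\<close>

lemma cl_eq:
  assumes "f \<in> cochains Q" shows "cl f = proj ` {g \<in> cochains Q. homologous g f}"
proof -
  have "cl f = (\<lambda>b. proj (kdiff V x b) \<oplus>\<^bsub>ext_algebra R V\<^esub> proj f) ` cochains Q"
    unfolding cl_def koszul_class_def a_r_coset_def r_coset_def koszul_boundaries_eq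
    by (auto simp: koszul_cycle_ring_def)
  also have "\<dots> = (\<lambda>b. proj (\<lambda>S. kdiff V x b S + f S)) ` cochains Q"
    using assms by (auto simp: proj_add cochains_kdiff)
  also have "\<dots> = proj ` {g \<in> cochains Q. homologous g f}"
  proof (intro equalityI subsetI; elim imageE)
    fix F b assume "b \<in> cochains Q" "F = proj (\<lambda>S. kdiff V x b S + f S)"
    then show "F \<in> proj ` {g \<in> cochains Q. homologous g f}"
      using assms cochains_zero
      by (auto simp: homologous_def cochains_add cochains_kdiff intro!: imageI bexI[of _ b])
  next
    fix F g assume F: "F = proj g" and "g \<in> {g \<in> cochains Q. homologous g f}"
    then obtain b where g: "g \<in> cochains Q" "b \<in> cochains Q"
      "(\<lambda>S. g S - f S - kdiff V x b S) \<in> cochains K" by (auto simp: homologous_def)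
    have "F = proj (\<lambda>S. kdiff V x b S + f S)"
      unfolding F using g assms
      by (subst proj_eq_iff) (auto simp: cochains_add cochains_kdiff algebra_simps)
    then show "F \<in> (\<lambda>b. proj (\<lambda>S. kdiff V x b S + f S)) ` cochains Q" using g by auto
  qed
  finally show ?thesis .
qed

lemma cl_cong:
  assumes "f \<in> cochains Q" "g \<in> cochains Q" "homologous f g" shows "cl f = cl g"
proof -
  have "homologous k f \<longleftrightarrow> homologous k g" for k
    using assms(3) homologous_sym homologous_trans by blast
  then show ?thesis using assms(1,2) by (simp add: cl_eq)
qed

lemma carrier_H: "carrier H = cl ` cycles"
  by (auto simp: koszul_homology_def FactRing_def A_RCOSETS_def RCOSETS_def koszul_cycle_ring_def
      koszul_cycles_eq cl_def koszul_class_def a_r_coset_def)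

lemma H_zero: "\<zero>\<^bsub>H\<^esub> = cl (\<lambda>S. 0)"
proof -
  have "{g \<in> cochains Q. homologous g (\<lambda>S. 0)} =
    {g \<in> cochains Q. \<exists>b\<in>cochains Q. (\<lambda>S. g S - kdiff V x b S) \<in> cochains K}"
    by (simp add: homologous_def)
  moreover have "proj ` \<dots> = (\<lambda>b. proj (kdiff V x b)) ` cochains Q"
    using cochains_kdiff cochains_zero proj_eq_iff by (auto simp: image_iff) blast+
  ultimately show ?thesis
    by (simp add: koszul_homology_def FactRing_def koszul_boundaries_eq cl_eq cochains_zero)
qed

lemma H_add:
  assumes "f \<in> cycles" "g \<in> cycles"
  shows "cl f \<oplus>\<^bsub>H\<^esub> cl g = cl (\<lambda>S. f S + g S)"
proof -
  note fg = assms[THEN cycles_cochains]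
  have "cl f \<oplus>\<^bsub>H\<^esub> cl g = (\<Union>a\<in>cl f. \<Union>b\<in>cl g. {a \<oplus>\<^bsub>ext_algebra R V\<^esub> b})"
    by (simp add: koszul_homology_def FactRing_def set_add_def set_mult_def koszul_cycle_ring_def)
  also have "\<dots> = proj ` {k \<in> cochains Q. homologous k (\<lambda>S. f S + g S)}"
  proof (intro equalityI subsetI)
    fix F assume "F \<in> (\<Union>a\<in>cl f. \<Union>b\<in>cl g. {a \<oplus>\<^bsub>ext_algebra R V\<^esub> b})"
    then obtain f' g' where "f' \<in> cochains Q" "g' \<in> cochains Q" "homologous f' f" "homologous g' g"
      "F = proj f' \<oplus>\<^bsub>ext_algebra R V\<^esub> proj g'"
      using fg by (auto simp: cl_eq)
    then show "F \<in> proj ` {k \<in> cochains Q. homologous k (\<lambda>S. f S + g S)}"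
      by (auto simp: proj_add cochains_add homologous_add)
  next
    fix F assume "F \<in> proj ` {k \<in> cochains Q. homologous k (\<lambda>S. f S + g S)}"
    then obtain k where k: "k \<in> cochains Q" "homologous k (\<lambda>S. f S + g S)" "F = proj k" by auto
    have "F = proj (\<lambda>S. k S - g S) \<oplus>\<^bsub>ext_algebra R V\<^esub> proj g"
      using k fg by (simp add: proj_add cochains_diff)
    moreover have "homologous (\<lambda>S. k S - g S) f"
      using homologous_add[OF k(2) homologous_refl[of "\<lambda>S. - g S"]] by simp
    then have "proj (\<lambda>S. k S - g S) \<in> cl f" using k fg by (auto simp: cl_eq cochains_diff)
    moreover have "proj g \<in> cl g" using fg by (auto simp: cl_eq homologous_refl)
    ultimately show "F \<in> (\<Union>a\<in>cl f. \<Union>b\<in>cl g. {a \<oplus>\<^bsub>ext_algebra R V\<^esub> b})" by blast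
  qed
  finally show ?thesis using fg by (simp add: cl_eq cochains_add)
qed

text \<open>The product in the quotient is a union of cosets over all choices of representatives;
  \<open>homologous_wedge\<close> makes all of these cosets equal.\<close>

lemma H_mult:
  assumes "f \<in> cycles" "g \<in> cycles"
  shows "cl f \<otimes>\<^bsub>H\<^esub> cl g = cl (wedge f g)"
proof -
  note fg = assms[THEN cycles_cochains]
  have "cl f \<otimes>\<^bsub>H\<^esub> cl g = (\<Union>a\<in>cl f. \<Union>b\<in>cl g. koszul_class R V (\<lambda>v. h (x v)) (a \<otimes>\<^bsub>ext_algebra R V\<^esub> b))"
    by (simp add: koszul_homology_def FactRing_def rcoset_mult_def koszul_class_def koszul_cycle_ring_def)
  also have "\<dots> = (\<Union>a\<in>cl f. \<Union>b\<in>cl g. cl (wedge f g))"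
  proof (intro SUP_cong refl)
    fix a b assume "a \<in> cl f" "b \<in> cl g"
    then obtain f' g' where fg': "f' \<in> cochains Q" "g' \<in> cochains Q" "homologous f' f" "homologous g' g"
      "a = proj f'" "b = proj g'"
      using fg by (auto simp: cl_eq)
    then have "koszul_class R V (\<lambda>v. h (x v)) (a \<otimes>\<^bsub>ext_algebra R V\<^esub> b) = cl (wedge f' g')"
      by (simp add: ext_mult_proj cl_def)
    also have "\<dots> = cl (wedge f g)"
      using fg fg' assms by (intro cl_cong cochains_wedge homologous_wedge)
    finally show "koszul_class R V (\<lambda>v. h (x v)) (a \<otimes>\<^bsub>ext_algebra R V\<^esub> b) = cl (wedge f g)" .
  qed
  also have "\<dots> = cl (wedge f g)"
  proof -
    \<comment> \<open>The index sets of the union have to be nonempty for it to be the common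
      coset.\<close>
    have "proj f \<in> cl f" "proj g \<in> cl g" using fg by (auto simp: cl_eq homologous_refl)
    then show ?thesis by auto
  qed
  finally show ?thesis .
qed

text \<open>Provides closure under negation and finite sums, for the generated subring and for
  \<open>sum_of_subgroups\<close>.\<close>

lemma abelian_group_H: "abelian_group H"
proof (rule abelian_groupI)
  show "\<zero>\<^bsub>H\<^esub> \<in> carrier H" by (simp add: H_zero carrier_H cycles_zero)
  fix a assume "a \<in> carrier H"
  then obtain f where f: "f \<in> cycles" "a = cl f" by (auto simp: carrier_H)
  then show "\<zero>\<^bsub>H\<^esub> \<oplus>\<^bsub>H\<^esub> a = a" by (simp add: H_zero H_add cycles_zero)
  have "cl (\<lambda>S. - f S) \<oplus>\<^bsub>H\<^esub> a = \<zero>\<^bsub>H\<^esub>"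
    using f by (simp add: H_zero H_add cycles_uminus)
  then show "\<exists>y\<in>carrier H. y \<oplus>\<^bsub>H\<^esub> a = \<zero>\<^bsub>H\<^esub>"
    using f cycles_uminus by (auto simp: carrier_H)
qed (auto simp: carrier_H H_add cycles_add add_ac)

end


section \<open>Leaves of forests\<close>

text \<open>Passes from vertex lists, in which a longest path is easy to extend, to the arc lists on
  which walks and cycles are defined.\<close>

lemma pawalk_of_successively:
  assumes "successively (\<lambda>u v. (u, v) \<in> E) (a # xs)"
  shows "pcas a (zip (a # xs) xs) (last (a # xs))"
    and "pawalk_verts a (zip (a # xs) xs) = a # xs"
    and "set (zip (a # xs) xs) \<subseteq> E"
  using assms by (induction xs arbitrary: a) auto

text \<open>Take a longest path inside \<open>P\<close>. If its first vertex had two neighbours in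
  \<open>P\<close>, both would lie on the path by maximality, and the one that is not next on the
  path would close a cycle.\<close>

lemma tree_graph_leaf:
  assumes "tree_graph T" "P \<subseteq> pverts T" "P \<noteq> {}"
  obtains v where "v \<in> P"
    "\<And>a b. a \<in> P \<Longrightarrow> b \<in> P \<Longrightarrow> (v, a) \<in> parcs T \<Longrightarrow> (v, b) \<in> parcs T \<Longrightarrow> a = b"
proof (rule ccontr)
  assume "\<not> thesis"
  with that have two: "\<exists>a\<in>P. \<exists>b\<in>P. (v, a) \<in> parcs T \<and> (v, b) \<in> parcs T \<and> a \<noteq> b" if "v \<in> P" for v
    using \<open>v \<in> P\<close> by blast
  from assms(1) interpret pair_graph T by (simp add: tree_graph_def)
  define path where "path xs \<longleftrightarrow> xs \<noteq> [] \<and> distinct xs \<and> set xs \<subseteq> P \<and>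
    successively (\<lambda>u v. (u, v) \<in> parcs T) xs" for xs
  from assms(3) obtain v0 where "v0 \<in> P" by blast
  then have "path [v0]" by (simp add: path_def)
  moreover have "length xs \<le> card (pverts T)" if "path xs" for xs
    using that assms(2) card_mono[OF pair_finite_verts, of "set xs"]
    by (auto simp: path_def distinct_card)
  then have "\<forall>xs. path xs \<longrightarrow> length xs < Suc (card (pverts T))"
    by (simp add: less_Suc_eq_le)
  ultimately obtain xs where xs: "path xs" "\<And>ys. path ys \<Longrightarrow> length ys \<le> length xs"
    using ex_has_greatest_nat[of path "[v0]" length "Suc (card (pverts T))"] by metis
  then obtain y ys where y: "xs = y # ys" by (cases xs) (auto simp: path_def)
  with xs have "y \<in> P" by (auto simp: path_def)
  \<comment> \<open>Of two distinct neighbours at least one differs from the second vertex of the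
    path.\<close>
  then obtain w where w: "w \<in> P" "(y, w) \<in> parcs T" "ys \<noteq> [] \<longrightarrow> w \<noteq> hd ys"
    using two by metis
  have "(w, y) \<in> parcs T" using w(2) pair_sym_arcs by (auto simp: symmetric_def dest: symD)
  have "w \<noteq> y" using w(2) pair_no_loops by fastforce
  have "w \<in> set ys"
  proof (rule ccontr)
    assume "w \<notin> set ys"
    then have "path (w # xs)"
      using xs(1) w \<open>(w, y) \<in> parcs T\<close> \<open>w \<noteq> y\<close> by (auto simp: path_def y)
    from xs(2)[OF this] show False by simp
  qed
  then obtain us vs where ys: "ys = us @ w # vs" using split_list by fast
  \<comment> \<open>As \<open>w\<close> is not the second vertex, something lies between
    \<open>y\<close> and \<open>w\<close>. This rules out the closed walk along a single edge and
    yields length at least 3.\<close>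
  with w(3) have "us \<noteq> []" by auto
  let ?zs = "y # us @ [w]"
  have zs: "distinct ?zs" "set ?zs \<subseteq> P" "successively (\<lambda>u v. (u, v) \<in> parcs T) ?zs"
  proof -
    have "xs = ?zs @ vs" by (simp add: y ys)
    with xs(1) show "distinct ?zs" "set ?zs \<subseteq> P" "successively (\<lambda>u v. (u, v) \<in> parcs T) ?zs"
      unfolding path_def by (simp_all only: distinct_append set_append successively_append_iff Un_subset_iff)
  qed
  define p where "p = (w, y) # zip ?zs (us @ [w])"
  have "awalk w p w" "distinct (tl (pawalk_verts w p))"
    using pawalk_of_successively[OF zs(3)] zs \<open>(w, y) \<in> parcs T\<close> w(1) assms(2)
    by (auto simp: p_def awalk_def)
  then have "cycle p" unfolding cycle_def by (auto simp: p_def)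
  moreover have "3 \<le> length p" using \<open>us \<noteq> []\<close> by (cases us) (auto simp: p_def)
  ultimately have "simple_cycle T p" by (simp add: simple_cycle_def)
  with assms(1) show False by (auto simp: tree_graph_def)
qed

text \<open>The leaf is taken in a single tree that meets \<open>P\<close>; it remains a leaf
  because no edge leaves that tree.\<close>

lemma forest_graph_leaf:
  assumes "forest_graph G" "P \<subseteq> pverts G" "P \<noteq> {}"
  obtains v where "v \<in> P"
    "\<And>a b. a \<in> P \<Longrightarrow> b \<in> P \<Longrightarrow> (v, a) \<in> parcs G \<Longrightarrow> (v, b) \<in> parcs G \<Longrightarrow> a = b"
proof -
  from assms(1) obtain F where F: "\<And>T. T \<in> F \<Longrightarrow> tree_graph T"
    "\<And>T T'. T \<in> F \<Longrightarrow> T' \<in> F \<Longrightarrow> T \<noteq> T' \<Longrightarrow> pverts T \<inter> pverts T' = {}"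
    "pverts G = (\<Union>T\<in>F. pverts T)" "parcs G = (\<Union>T\<in>F. parcs T)"
    unfolding forest_graph_def by metis
  from assms(2,3) F(3) obtain T where T: "T \<in> F" "P \<inter> pverts T \<noteq> {}" by blast
  from tree_graph_leaf[OF F(1)[OF T(1)] Int_lower2 T(2)] obtain v where v: "v \<in> P \<inter> pverts T"
    "\<And>a b. a \<in> P \<inter> pverts T \<Longrightarrow> b \<in> P \<inter> pverts T \<Longrightarrow>
      (v, a) \<in> parcs T \<Longrightarrow> (v, b) \<in> parcs T \<Longrightarrow> a = b" by metis
  \<comment> \<open>The tree containing this arc also contains \<open>v\<close>, so by disjointness
    it is \<open>T\<close>.\<close>
  have "(v, a) \<in> parcs T \<and> a \<in> pverts T" if va: "(v, a) \<in> parcs G" for a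
  proof -
    from va F(4) obtain T' where T': "T' \<in> F" "(v, a) \<in> parcs T'" by blast
    interpret T': pair_graph T' using F(1)[OF T'(1)] by (simp add: tree_graph_def)
    from T'(2) have "v \<in> pverts T'" "a \<in> pverts T'" by (auto dest: T'.in_arcsD1 T'.in_arcsD2)
    then have "T' = T" using F(2)[OF T'(1) T(1)] v(1) by blast
    then show ?thesis using T'(2) \<open>a \<in> pverts T'\<close> by simp
  qed
  with v show ?thesis by (intro that[of v]) auto
qed


section \<open>Edge ideals\<close>

lemma carrier_mpoly_ring:
  "carrier (mpoly_ring V) = {p. \<forall>m\<in>Poly_Mapping.keys p. Poly_Mapping.keys m \<subseteq> V}"
  by (simp add: mpoly_ring_def)

lemma mpoly_ring_simps:
  "p \<oplus>\<^bsub>mpoly_ring V\<^esub> q = p + q" "p \<otimes>\<^bsub>mpoly_ring V\<^esub> q = p * q"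
  "\<zero>\<^bsub>mpoly_ring V\<^esub> = 0" "\<one>\<^bsub>mpoly_ring V\<^esub> = 1"
  by (simp_all add: mpoly_ring_def)

lemma keys_add_nat: "Poly_Mapping.keys (m + n) = Poly_Mapping.keys m \<union> Poly_Mapping.keys (n :: 'v \<Rightarrow>\<^sub>0 nat)"
  by (auto simp: in_keys_iff lookup_add)

lemma keys_uminus_eq: "Poly_Mapping.keys (- p) = Poly_Mapping.keys (p :: 'm \<Rightarrow>\<^sub>0 'k::ab_group_add)"
  by (auto simp: in_keys_iff)

lemma mpoly_ring_closed:
  "1 \<in> carrier (mpoly_ring V)"
  "p \<in> carrier (mpoly_ring V) \<Longrightarrow> q \<in> carrier (mpoly_ring V) \<Longrightarrow> p + q \<in> carrier (mpoly_ring V)"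
  "p \<in> carrier (mpoly_ring V) \<Longrightarrow> - p \<in> carrier (mpoly_ring V)"
  "p \<in> carrier (mpoly_ring V) \<Longrightarrow> q \<in> carrier (mpoly_ring V) \<Longrightarrow> p * q \<in> carrier (mpoly_ring V)"
  "v \<in> V \<Longrightarrow> mpoly_var v \<in> carrier (mpoly_ring V)"
proof -
  show "p \<in> carrier (mpoly_ring V) \<Longrightarrow> q \<in> carrier (mpoly_ring V) \<Longrightarrow> p + q \<in> carrier (mpoly_ring V)"
    using keys_add[of p q] by (auto simp: carrier_mpoly_ring)
  show "p \<in> carrier (mpoly_ring V) \<Longrightarrow> q \<in> carrier (mpoly_ring V) \<Longrightarrow> p * q \<in> carrier (mpoly_ring V)"
    using keys_mult[of p q] by (fastforce simp: carrier_mpoly_ring keys_add_nat)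
qed (auto simp: carrier_mpoly_ring keys_uminus_eq mpoly_var_def)

lemma single_closed: "Poly_Mapping.keys m \<subseteq> V \<Longrightarrow> Poly_Mapping.single m c \<in> carrier (mpoly_ring V)"
  by (simp add: carrier_mpoly_ring)

lemma cring_mpoly_ring: "cring (mpoly_ring V :: ('v, 'k::field) mpoly ring)"
proof (rule cringI)
  show "abelian_group (mpoly_ring V :: ('v, 'k) mpoly ring)"
  proof (rule abelian_groupI)
    fix p :: "('v, 'k) mpoly" assume "p \<in> carrier (mpoly_ring V)"
    then show "\<exists>q\<in>carrier (mpoly_ring V). q \<oplus>\<^bsub>mpoly_ring V\<^esub> p = \<zero>\<^bsub>mpoly_ring V\<^esub>"
      by (intro bexI[of _ "- p"]) (auto simp: mpoly_ring_closed mpoly_ring_simps)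
  qed (auto simp: mpoly_ring_closed mpoly_ring_simps add_ac, simp add: carrier_mpoly_ring)
  show "Group.comm_monoid (mpoly_ring V :: ('v, 'k) mpoly ring)"
    by (rule comm_monoidI) (auto simp: mpoly_ring_closed mpoly_ring_simps mult_ac)
qed (auto simp: mpoly_ring_simps distrib_right)

text \<open>Independent sets. A monomial lies outside the edge ideal exactly when its support is
  one.\<close>

definition stable :: "'v rel \<Rightarrow> 'v set \<Rightarrow> bool" where
  "stable E W \<longleftrightarrow> (\<forall>u\<in>W. \<forall>v\<in>W. (u, v) \<notin> E)"

lemma poly_mapping_sum_singles:
  "p = (\<Sum>m\<in>Poly_Mapping.keys p. Poly_Mapping.single m (Poly_Mapping.lookup p m))"
proof (rule poly_mapping_eqI)
  fix m
  show "Poly_Mapping.lookup p m =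
    Poly_Mapping.lookup (\<Sum>m\<in>Poly_Mapping.keys p. Poly_Mapping.single m (Poly_Mapping.lookup p m)) m"
    by (auto simp: lookup_sum lookup_single when_def in_keys_iff sum.delta)
qed

text \<open>Multiplying a monomial only enlarges its support, so the right-hand side is an ideal,
  and it contains the generators. Conversely, a monomial with an edge in its support is divisible by
  the corresponding generator. This makes membership a condition on each monomial
  separately.\<close>

lemma edge_ideal_eq:
  fixes G :: "'v pair_pre_digraph"
  assumes "pair_graph G"
  shows "edge_ideal G = {p \<in> carrier (mpoly_ring (pverts G) :: ('v, 'k::field) mpoly ring).
    \<forall>m\<in>Poly_Mapping.keys p. \<not> stable (parcs G) (Poly_Mapping.keys m)}" (is "_ = ?J")
    and "ideal (edge_ideal G) (mpoly_ring (pverts G) :: ('v, 'k::field) mpoly ring)"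
proof -
  interpret pair_graph G by fact
  let ?Q = "mpoly_ring (pverts G) :: ('v, 'k) mpoly ring"
  let ?S = "{mpoly_var u * mpoly_var v :: ('v, 'k) mpoly | u v. (u, v) \<in> parcs G}"
  interpret Q: cring ?Q by (rule cring_mpoly_ring)
  have S: "?S \<subseteq> carrier ?Q" using in_arcsD1 in_arcsD2 by (auto simp: mpoly_ring_closed)
  have I: "edge_ideal G = Idl\<^bsub>?Q\<^esub> ?S" by (simp add: edge_ideal_def)
  show id: "ideal (edge_ideal G) ?Q" unfolding I by (rule Q.genideal_ideal[OF S])
  interpret id: ideal "edge_ideal G" ?Q by (rule id)
  have mono: "stable (parcs G) W" if "stable (parcs G) W'" "W \<subseteq> W'" for W W'
    using that by (auto simp: stable_def)
  have minus: "\<ominus>\<^bsub>?Q\<^esub> p = - p" if "p \<in> carrier ?Q" for p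
    by (rule Q.minus_equality) (use that in \<open>auto simp: mpoly_ring_closed mpoly_ring_simps\<close>)
  show "edge_ideal G = ?J"
  proof
    show "edge_ideal G \<subseteq> ?J"
      unfolding I
    proof (rule Q.genideal_minimal)
      have JQ: "p * q \<in> ?J" if "p \<in> ?J" "q \<in> carrier ?Q" for p q
      proof -
        have "\<not> stable (parcs G) (Poly_Mapping.keys m)" if "m \<in> Poly_Mapping.keys (p * q)" for m
        proof -
          from that keys_mult[of p q] obtain a b where "m = a + b" "a \<in> Poly_Mapping.keys p" by blast
          then show ?thesis using \<open>p \<in> ?J\<close> mono[of "Poly_Mapping.keys m" "Poly_Mapping.keys a"]
            by (auto simp: keys_add_nat)
        qed
        then show ?thesis using that by (auto simp: mpoly_ring_closed)
      qed
      show "ideal ?J ?Q"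
      proof (rule idealI)
        show "subgroup ?J (add_monoid ?Q)"
        proof (rule Group.group.subgroupI[OF Q.a_group])
          have "0 \<in> ?J" using Q.zero_closed by (simp add: mpoly_ring_simps)
          then show "?J \<noteq> {}" by blast
          fix p q assume pq: "p \<in> ?J" "q \<in> ?J"
          then have "p + q \<in> ?J" using keys_add[of p q] by (auto simp: mpoly_ring_closed)
          then show "p \<otimes>\<^bsub>add_monoid ?Q\<^esub> q \<in> ?J" by (simp add: mpoly_ring_simps)
          have "\<ominus>\<^bsub>?Q\<^esub> p \<in> ?J" using pq by (auto simp: minus keys_uminus_eq mpoly_ring_closed)
          then show "inv\<^bsub>add_monoid ?Q\<^esub> p \<in> ?J" by (simp add: a_inv_def)
        qed (simp add: Collect_mono_iff)
        fix p q assume "p \<in> ?J" "q \<in> carrier ?Q"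
        then show "q \<otimes>\<^bsub>?Q\<^esub> p \<in> ?J" "p \<otimes>\<^bsub>?Q\<^esub> q \<in> ?J"
          using JQ[of p q] by (auto simp: mpoly_ring_simps mult.commute)
      qed (rule Q.ring_axioms)
      have "\<not> stable (parcs G) (Poly_Mapping.keys (Poly_Mapping.single u (1::nat) + Poly_Mapping.single v 1))"
        if "(u, v) \<in> parcs G" for u v
        using that by (auto simp: stable_def keys_add_nat)
      then have "?S \<subseteq> {p. \<forall>m\<in>Poly_Mapping.keys p. \<not> stable (parcs G) (Poly_Mapping.keys m)}"
        by (auto simp: mpoly_var_def mult_single)
      with S show "?S \<subseteq> ?J" by blast
    qed
    have mon: "Poly_Mapping.single m c \<in> edge_ideal G"
      if m: "Poly_Mapping.keys m \<subseteq> pverts G" "\<not> stable (parcs G) (Poly_Mapping.keys m)" for m and c :: 'k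
    proof -
      from m obtain u v where uv: "u \<in> Poly_Mapping.keys m" "v \<in> Poly_Mapping.keys m" "(u, v) \<in> parcs G"
        by (auto simp: stable_def)
      with pair_no_loops have "u \<noteq> v" by fastforce
      \<comment> \<open>The truncated subtraction is exact: both vertices are in the support, and
        they differ because there are no loops.\<close>
      define m' where "m' = m - (Poly_Mapping.single u 1 + Poly_Mapping.single v 1)"
      have mm: "m = Poly_Mapping.single u 1 + Poly_Mapping.single v 1 + m'"
        using uv \<open>u \<noteq> v\<close>
        by (intro poly_mapping_eqI)
          (auto simp: m'_def lookup_add lookup_minus lookup_single when_def in_keys_iff)
      have "Poly_Mapping.single m c = (mpoly_var u * mpoly_var v) * Poly_Mapping.single m' c"
        by (simp add: mm mpoly_var_def mult_single)
      moreover have "(mpoly_var u * mpoly_var v :: ('v, 'k) mpoly) \<in> edge_ideal G"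
      proof -
        have "(mpoly_var u * mpoly_var v :: ('v, 'k) mpoly) \<in> ?S" using uv(3) by blast
        then show ?thesis unfolding I using Q.genideal_self[OF S] by (rule rev_subsetD)
      qed
      moreover have "Poly_Mapping.single m' c \<in> carrier ?Q"
        using m(1) unfolding mm by (intro single_closed) (auto simp: keys_add_nat)
      ultimately show ?thesis
        using id.I_r_closed[of "mpoly_var u * mpoly_var v" "Poly_Mapping.single m' c"]
        by (simp add: mpoly_ring_simps)
    qed
    have sum: "sum f A \<in> edge_ideal G" if "finite A" "\<And>a. a \<in> A \<Longrightarrow> f a \<in> edge_ideal G"
      for A and f :: "_ \<Rightarrow> ('v, 'k) mpoly"
      using that
    proof induction
      case empty
      then show ?case using id.zero_closed by (simp add: mpoly_ring_simps)
    next
      case (insert a A)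
      then have "f a \<oplus>\<^bsub>?Q\<^esub> sum f A \<in> edge_ideal G" by (intro id.a_closed) auto
      then show ?case using insert by (simp add: mpoly_ring_simps)
    qed
    show "?J \<subseteq> edge_ideal G"
    proof
      fix p assume "p \<in> ?J"
      then have "(\<Sum>m\<in>Poly_Mapping.keys p. Poly_Mapping.single m (Poly_Mapping.lookup p m)) \<in> edge_ideal G"
        by (intro sum mon) (auto simp: carrier_mpoly_ring)
      then show "p \<in> edge_ideal G" by (simp flip: poly_mapping_sum_singles)
    qed
  qed
qed

lemma koszul_presentation_edge_ring:
  fixes G :: "'v::linorder pair_pre_digraph"
  assumes "pair_graph G"
  shows "koszul_presentation (edge_ring G) (carrier (mpoly_ring (pverts G) :: ('v, 'k::field) mpoly ring))
    (edge_ring_class G) (pverts G) mpoly_var"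
proof -
  interpret pair_graph G by fact
  let ?Q = "mpoly_ring (pverts G) :: ('v, 'k) mpoly ring"
  interpret Q: cring ?Q by (rule cring_mpoly_ring)
  interpret id: ideal "edge_ideal G" ?Q by (rule edge_ideal_eq(2)) fact
  interpret R: cring "edge_ring G :: ('v, 'k) mpoly set ring"
    unfolding edge_ring_def by (rule id.quotient_is_cring) (rule Q.cring_axioms)
  have hom: "edge_ring_class G \<in> ring_hom ?Q (edge_ring G)"
    using id.rcos_ring_hom by (simp add: edge_ring_class_def[abs_def] edge_ring_def)
  show ?thesis
  proof
    show "edge_ring_class G ` carrier ?Q = carrier (edge_ring G)"
      by (auto simp: edge_ring_class_def[abs_def] edge_ring_def FactRing_def A_RCOSETS_def'
          RCOSETS_def a_r_coset_def)
    show "edge_ring_class G (1 :: ('v, 'k) mpoly) = \<one>\<^bsub>edge_ring G\<^esub>"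
      using ring_hom_one[OF hom] by (simp add: mpoly_ring_simps)
    fix p q :: "('v, 'k) mpoly" assume "p \<in> carrier ?Q" "q \<in> carrier ?Q"
    from ring_hom_add[OF hom this] ring_hom_mult[OF hom this]
    show "edge_ring_class G (p + q) = edge_ring_class G p \<oplus>\<^bsub>edge_ring G\<^esub> edge_ring_class G q"
      "edge_ring_class G (p * q) = edge_ring_class G p \<otimes>\<^bsub>edge_ring G\<^esub> edge_ring_class G q"
      by (simp_all add: mpoly_ring_simps)
  qed (auto simp: pair_finite_verts mpoly_ring_closed)
qed

lemma koszul_presentation_K_edge_ring:
  fixes G :: "'v::linorder pair_pre_digraph"
  assumes "pair_graph G"
  shows "koszul_presentation.K (edge_ring G) (carrier (mpoly_ring (pverts G)))
    (edge_ring_class G) = (edge_ideal G :: ('v, 'k::field) mpoly set)"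
proof -
  let ?Q = "mpoly_ring (pverts G) :: ('v, 'k) mpoly ring"
  interpret Q: cring ?Q by (rule cring_mpoly_ring)
  interpret id: ideal "edge_ideal G" ?Q by (rule edge_ideal_eq(2)) fact
  have "\<zero>\<^bsub>edge_ring G\<^esub> = (edge_ideal G :: ('v, 'k) mpoly set)"
    by (simp add: edge_ring_def FactRing_def)
  then show ?thesis
    unfolding koszul_presentation.K_def[OF koszul_presentation_edge_ring[OF assms]]
    using id.rcos_const_imp_mem Q.a_rcos_zero[OF id.ideal_axioms] id.a_subset
    by (auto simp: edge_ring_class_def)
qed


section \<open>Cycles modulo an edge ideal\<close>

lemma keys_diff_subset: "Poly_Mapping.keys (a - b) \<subseteq> Poly_Mapping.keys (a :: 'v \<Rightarrow>\<^sub>0 nat)"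
  by (auto simp: in_keys_iff lookup_minus)

text \<open>The multidegree of \<open>dx_S\<close>, that is, the exponent of the squarefree monomial
  with support \<open>S\<close>.\<close>

definition ind :: "'v set \<Rightarrow> 'v \<Rightarrow>\<^sub>0 nat" where
  "ind S = (\<Sum>v\<in>S. Poly_Mapping.single v 1)"

lemma lookup_ind: "finite S \<Longrightarrow> Poly_Mapping.lookup (ind S) v = (if v \<in> S then 1 else 0)"
  by (auto simp: ind_def lookup_sum lookup_single when_def)

lemma keys_ind: "finite S \<Longrightarrow> Poly_Mapping.keys (ind S) = S"
  by (auto simp: in_keys_iff lookup_ind split: if_splits)

text \<open>The homogeneous form \<open>\<Sum>\<^sub>S c(S) x\<^bsup>a - S\<^esup> dx\<^sub>S\<close> of multidegree \<open>a\<close>.\<close>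

definition mon :: "('v \<Rightarrow>\<^sub>0 nat) \<Rightarrow> ('v set \<Rightarrow> 'k) \<Rightarrow> 'v set \<Rightarrow> ('v, 'k::field) mpoly" where
  "mon a c S = (if S \<subseteq> Poly_Mapping.keys a then Poly_Mapping.single (a - ind S) (c S) else 0)"

lemma single_sum: "(\<Sum>i\<in>I. Poly_Mapping.single m (f i)) = Poly_Mapping.single m (sum f I)"
  by (induction I rule: infinite_finite_induct) (auto simp: single_add)

lemma sign_single: "(-1) ^ n * Poly_Mapping.single m c = Poly_Mapping.single m ((-1) ^ n * c :: 'k::field)"
  by (cases "even n") (auto simp: single_uminus)

lemma lookup_sign_mult:
  "Poly_Mapping.lookup ((-1) ^ n * p) m = (-1) ^ n * Poly_Mapping.lookup (p :: ('v, 'k::field) mpoly) m"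
  by (cases "even n") auto

lemma lookup_var_mult:
  "Poly_Mapping.lookup (mpoly_var v * p) n =
    (if v \<in> Poly_Mapping.keys n then Poly_Mapping.lookup p (n - Poly_Mapping.single v 1) else 0)"
proof -
  have eq: "Poly_Mapping.single v 1 + m = n \<longleftrightarrow>
      v \<in> Poly_Mapping.keys n \<and> m = n - Poly_Mapping.single v 1" for m
  proof
    assume "v \<in> Poly_Mapping.keys n \<and> m = n - Poly_Mapping.single v 1"
    then show "Poly_Mapping.single v 1 + m = n"
      by (intro poly_mapping_eqI) (auto simp: lookup_add lookup_minus lookup_single when_def in_keys_iff)
  qed (auto simp: keys_add_nat)
  have "mpoly_var v * p = (\<Sum>m\<in>Poly_Mapping.keys p. Poly_Mapping.single (Poly_Mapping.single v 1 + m) (Poly_Mapping.lookup p m))"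
    by (subst poly_mapping_sum_singles[of p])
      (simp add: mpoly_var_def sum_distrib_left mult_single)
  also have "Poly_Mapping.lookup \<dots> n =
    (\<Sum>m\<in>Poly_Mapping.keys p. if Poly_Mapping.single v 1 + m = n then Poly_Mapping.lookup p m else 0)"
    by (auto simp: lookup_sum lookup_single when_def intro!: sum.cong)
  also have "\<dots> = (if v \<in> Poly_Mapping.keys n then Poly_Mapping.lookup p (n - Poly_Mapping.single v 1) else 0)"
    unfolding eq by (auto simp: in_keys_iff[of _ p])
  finally show ?thesis .
qed

lemma single_add_diff_ind_insert:
  assumes "finite U" "v \<notin> U" "v \<in> Poly_Mapping.keys a"
  shows "Poly_Mapping.single v 1 + (a - ind (insert v U)) = a - ind U"
    and "a - ind U - Poly_Mapping.single v 1 = a - ind (insert v U)"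
  using assms
  by (auto intro!: poly_mapping_eqI simp: lookup_add lookup_minus lookup_single when_def in_keys_iff lookup_ind)

text \<open>Multiplying \<open>x^(a - S - v)\<close> by \<open>x_v\<close> gives
  \<open>x^(a - S)\<close>, so within a multidegree the monomials carry no information and only the
  simplicial boundary of the coefficients remains. The value 0 of \<open>mon\<close> outside the
  support excludes the sets for which \<open>a - ind S\<close> would be truncated.\<close>

lemma kdiff_mon:
  assumes "finite V" "Poly_Mapping.keys a \<subseteq> V" "U \<subseteq> V"
  shows "kdiff V mpoly_var (mon a c) U = mon a (kdiff (Poly_Mapping.keys a) (\<lambda>_. 1) c) U"
proof (cases "U \<subseteq> Poly_Mapping.keys a")
  case True
  have fU: "finite U" using finite_subset[OF assms(3,1)] .
  have "kdiff V mpoly_var (mon a c) U = (\<Sum>v\<in>Poly_Mapping.keys a - U.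
      (-1) ^ card {s\<in>U. s < v} * (mpoly_var v * mon a c (insert v U)))"
    unfolding kdiff_def using assms by (intro sum.mono_neutral_right) (auto simp: mon_def)
  also have "\<dots> = (\<Sum>v\<in>Poly_Mapping.keys a - U.
      Poly_Mapping.single (a - ind U) ((-1) ^ card {s\<in>U. s < v} * c (insert v U)))"
  proof (rule sum.cong[OF refl])
    fix v assume v: "v \<in> Poly_Mapping.keys a - U"
    then have "mpoly_var v * mon a c (insert v U) = Poly_Mapping.single (a - ind U) (c (insert v U))"
      using True single_add_diff_ind_insert(1)[of U v a] fU
      by (simp add: mon_def mpoly_var_def mult_single)
    then show "(-1) ^ card {s\<in>U. s < v} * (mpoly_var v * mon a c (insert v U)) =
      Poly_Mapping.single (a - ind U) ((-1) ^ card {s\<in>U. s < v} * c (insert v U))"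
      by (simp add: sign_single)
  qed
  finally show ?thesis using True by (simp add: single_sum mon_def kdiff_def)
qed (auto simp: kdiff_def mon_def)

lemma wedge_single:
  assumes "finite U"
  shows "wedge (\<lambda>S. if S = N then p else 0) g U =
    (if N \<subseteq> U then (-1) ^ inversions N (U - N) * (p * g (U - N)) else 0)"
proof -
  have "wedge (\<lambda>S. if S = N then p else 0) g U =
    (\<Sum>S\<in>Pow U. if S = N then (-1) ^ inversions N (U - N) * (p * g (U - N)) else 0)"
    unfolding wedge_def by (intro sum.cong) auto
  also have "\<dots> = (if N \<subseteq> U then (-1) ^ inversions N (U - N) * (p * g (U - N)) else 0)"
    using assms by (subst sum.delta) auto
  finally show ?thesis .
qed

text \<open>The edge ideal is replaced by its monomial description, so that only a symmetric
  irreflexive relation \<open>E\<close> is left of the graph.\<close>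

locale edge_koszul = koszul_presentation R "carrier (mpoly_ring V)" h V mpoly_var
  for R (structure) and h :: "('v::linorder, 'k::field) mpoly \<Rightarrow> 'a" and V +
  fixes E :: "'v rel"
  assumes K_eq: "K = {p \<in> carrier (mpoly_ring V). \<forall>m\<in>Poly_Mapping.keys p. \<not> stable E (Poly_Mapping.keys m)}"
    and sym_E: "sym E"
    and irrefl_E: "(v, v) \<notin> E"
begin

abbreviation Q :: "('v, 'k) mpoly set" where "Q \<equiv> carrier (mpoly_ring V)"

text \<open>The form \<open>x_u dx_N\<close>, named after the star graph with centre
  \<open>u\<close> and leaves \<open>N\<close>. Its homological degree is \<open>card N\<close> and
  its internal degree \<open>card N + 1\<close>.\<close>

definition star :: "'v \<Rightarrow> 'v set \<Rightarrow> 'v set \<Rightarrow> ('v, 'k) mpoly" where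
  "star u N = (\<lambda>S. if S = N then mpoly_var u else 0)"

text \<open>The representatives of the classes in the subalgebra generated by the stars. Closure
  under \<open>homologous\<close> makes membership depend on the homology class alone.\<close>

inductive_set gen :: "('v set \<Rightarrow> ('v, 'k) mpoly) set" where
  scalar: "(\<lambda>S. if S = {} then mpoly_const c else 0) \<in> gen"
| star: "u \<in> V \<Longrightarrow> N \<subseteq> V \<Longrightarrow> (\<And>w. w \<in> N \<Longrightarrow> (u, w) \<in> E) \<Longrightarrow> star u N \<in> gen"
| add: "f \<in> gen \<Longrightarrow> g \<in> gen \<Longrightarrow> (\<lambda>S. f S + g S) \<in> gen"
| wedge: "f \<in> gen \<Longrightarrow> g \<in> gen \<Longrightarrow> wedge f g \<in> gen"
| homologous: "f \<in> gen \<Longrightarrow> g \<in> cochains Q \<Longrightarrow> homologous g f \<Longrightarrow> g \<in> gen"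

lemma single_K_iff:
  "Poly_Mapping.keys m \<subseteq> V \<Longrightarrow> Poly_Mapping.single m c \<in> K \<longleftrightarrow> c = 0 \<or> \<not> stable E (Poly_Mapping.keys m)"
  by (cases "c = 0") (auto simp: K_eq single_closed zero_Q)

lemma cochains_mon: "Poly_Mapping.keys a \<subseteq> V \<Longrightarrow> mon a c \<in> cochains Q"
  using keys_diff_subset by (fastforce simp: cochains_def mon_def zero_Q intro!: single_closed)

text \<open>The differential has a single monomial at \<open>U\<close>. If its support is
  independent, it is not in the ideal, so its coefficient must vanish; otherwise the cycle condition
  says nothing at \<open>U\<close>.\<close>

lemma mon_cyclesD:
  assumes "mon a c \<in> cycles" "Poly_Mapping.keys a \<subseteq> V" "U \<subseteq> Poly_Mapping.keys a"
    "stable E (Poly_Mapping.keys (a - ind U))"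
  shows "kdiff (Poly_Mapping.keys a) (\<lambda>_. 1) c U = 0"
proof -
  have "U \<subseteq> V" using assms by auto
  then have "kdiff V mpoly_var (mon a c) U \<in> K"
    using assms(1) by (simp add: cycles_def cochains_def)
  then have "Poly_Mapping.single (a - ind U) (kdiff (Poly_Mapping.keys a) (\<lambda>_. 1) c U) \<in> K"
    using assms(3) by (simp add: kdiff_mon[OF finite_V assms(2) \<open>U \<subseteq> V\<close>] mon_def)
  then show ?thesis
    using assms keys_diff_subset[of a "ind U"] by (subst (asm) single_K_iff) auto
qed

lemma cycles_star:
  assumes "u \<in> V" "N \<subseteq> V" "\<And>w. w \<in> N \<Longrightarrow> (u, w) \<in> E" shows "star u N \<in> cycles"
proof -
  have edge: "mpoly_var w * mpoly_var u \<in> K" if "w \<in> N" for w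
  proof -
    have "\<not> stable E (Poly_Mapping.keys (Poly_Mapping.single w (1::nat) + Poly_Mapping.single u 1))"
      using assms(3)[OF that] by (auto simp: stable_def keys_add_nat)
    moreover have "w \<in> V" using that assms by auto
    ultimately show ?thesis
      unfolding mpoly_var_def mult_single using assms(1) by (subst single_K_iff) (auto simp: keys_add_nat)
  qed
  have "kdiff V mpoly_var (star u N) U \<in> K" if "U \<subseteq> V" for U
    unfolding kdiff_def star_def
  proof (intro sum_K mult_K[OF sign_Q])
    fix w
    show "mpoly_var w * (if insert w U = N then mpoly_var u else 0) \<in> K"
      using edge[of w] zero_K by (cases "insert w U = N") auto
  qed
  then show ?thesis using assms(1) by (auto simp: cycles_def cochains_def star_def zero_Q x_Q)
qed

lemma gen_cycles: "f \<in> gen \<Longrightarrow> f \<in> cycles"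
proof (induction rule: gen.induct)
  case (scalar c)
  have "kdiff V mpoly_var (\<lambda>S. if S = {} then mpoly_const c else 0) U = 0" for U
    by (simp add: kdiff_def)
  then show ?case
    by (auto simp: cycles_def cochains_def zero_Q zero_K mpoly_const_def single_closed)
qed (auto intro: cycles_star cycles_add cycles_wedge homologous_cycles)

lemma gen_zero: "(\<lambda>S. 0) \<in> gen"
  using scalar[of 0] by (simp add: mpoly_const_def cong: if_cong)

lemma gen_K: "f \<in> cochains K \<Longrightarrow> f \<in> gen"
  by (rule homologous[OF gen_zero]) (auto intro: homologous_K cochains_K)

lemma gen_sum: "(\<And>i. i \<in> I \<Longrightarrow> f i \<in> gen) \<Longrightarrow> (\<lambda>S. \<Sum>i\<in>I. f i S) \<in> gen"
  by (induction I rule: infinite_finite_induct) (auto simp: gen_zero intro: gen.add)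

text \<open>The full simplex on the support is a cone with apex \<open>v\<close>, and the cone
  contraction removes all terms without \<open>v\<close>. Afterwards the differential at
  \<open>S - {v}\<close> has the one term coming from \<open>S\<close>, so the cycle condition there
  concerns a single coefficient.\<close>

lemma clear_vertex:
  assumes a: "Poly_Mapping.keys a \<subseteq> V" and v: "v \<in> Poly_Mapping.keys a" and c: "mon a c \<in> cycles"
  obtains c' where "homologous (mon a c) (mon a c')" "mon a c' \<in> cycles"
    "\<And>S. S \<subseteq> Poly_Mapping.keys a \<Longrightarrow> v \<notin> S \<Longrightarrow> c' S = 0"
    "\<And>S. S \<subseteq> Poly_Mapping.keys a \<Longrightarrow> v \<in> S \<Longrightarrow>
      stable E (Poly_Mapping.keys (a - ind (S - {v}))) \<Longrightarrow> c' S = 0"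
proof -
  let ?P = "Poly_Mapping.keys a"
  \<comment> \<open>The cone over \<open>c\<close> with apex \<open>v\<close>; the sign is the one
    that \<open>kdiff\<close> attaches to inserting \<open>v\<close>, so that the boundary of
    \<open>b\<close> agrees with \<open>c\<close> on sets without \<open>v\<close>.\<close>
  define b where "b S = (if v \<in> S then (-1) ^ card {s\<in>S - {v}. s < v} * c (S - {v}) else 0)" for S
  define c' where "c' S = c S - kdiff ?P (\<lambda>_. 1) b S" for S
  \<comment> \<open>Inserting any \<open>w\<close> other than \<open>v\<close> gives a set that
    still lacks \<open>v\<close>, where \<open>e\<close> vanishes.\<close>
  have only_v: "kdiff ?P (\<lambda>_. 1) e S = (-1) ^ card {s\<in>S. s < v} * e (insert v S)"
    if "v \<notin> S" "\<And>T. T \<subseteq> ?P \<Longrightarrow> v \<notin> T \<Longrightarrow> e T = 0" "S \<subseteq> ?P" for e :: "'v set \<Rightarrow> 'k" and S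
  proof -
    have "e (insert w S) = 0" if "w \<in> ?P - S - {v}" for w
      using that \<open>v \<notin> S\<close> \<open>S \<subseteq> ?P\<close> by (intro \<open>\<And>T. T \<subseteq> ?P \<Longrightarrow> v \<notin> T \<Longrightarrow> e T = 0\<close>) auto
    then have "kdiff ?P (\<lambda>_. 1) e S = (\<Sum>w\<in>{v}. (-1) ^ card {s\<in>S. s < w} * (1 * e (insert w S)))"
      unfolding kdiff_def using that v by (intro sum.mono_neutral_right) auto
    then show ?thesis by simp
  qed
  have hom: "homologous (mon a c) (mon a c')"
    unfolding homologous_def
  proof (rule bexI)
    show "mon a b \<in> cochains Q" using a by (rule cochains_mon)
    have "mon a c S - mon a c' S - kdiff V mpoly_var (mon a b) S = 0" if "S \<subseteq> V" for S
      unfolding kdiff_mon[OF finite_V a that] by (simp add: mon_def c'_def single_diff)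
    then show "(\<lambda>S. mon a c S - mon a c' S - kdiff V mpoly_var (mon a b) S) \<in> cochains K"
      by (simp add: cochains_def zero_K)
  qed
  have cyc: "mon a c' \<in> cycles" using homologous_cycles[OF homologous_sym[OF hom] c] .
  have zero: "c' S = 0" if "S \<subseteq> ?P" "v \<notin> S" for S
  proof -
    have "kdiff ?P (\<lambda>_. 1) b S = (-1) ^ card {s\<in>S. s < v} * b (insert v S)"
      by (rule only_v) (use that in \<open>auto simp: b_def\<close>)
    also have "b (insert v S) = (-1) ^ card {s\<in>S. s < v} * c S" using that by (simp add: b_def)
    also have "(-1) ^ card {s\<in>S. s < v} * \<dots> = c S"
      by (simp add: mult.assoc[symmetric] power_add[symmetric] mult_2[symmetric])
    finally show ?thesis by (simp add: c'_def)
  qed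
  show ?thesis
  proof (rule that[OF hom cyc zero])
    fix S assume S: "S \<subseteq> ?P" "v \<in> S" "stable E (Poly_Mapping.keys (a - ind (S - {v})))"
    have "kdiff ?P (\<lambda>_. 1) c' (S - {v}) = 0"
      by (rule mon_cyclesD[OF cyc a _ S(3)]) (use S in auto)
    moreover have "kdiff ?P (\<lambda>_. 1) c' (S - {v}) = (-1) ^ card {s\<in>S - {v}. s < v} * c' (insert v (S - {v}))"
      by (rule only_v) (use S zero in auto)
    ultimately show "c' S = 0" using S(2) by (simp add: insert_absorb)
  qed
qed

text \<open>The induction runs over the size of the support, and the hypothesis
  \<open>leaf_ex\<close> concerns all vertex sets because the support shrinks in an uncontrolled
  way.\<close>

lemma gen_mon:
  assumes leaf_ex: "\<And>P. P \<subseteq> V \<Longrightarrow> P \<noteq> {} \<Longrightarrow> \<exists>v\<in>P. \<forall>a\<in>P. \<forall>b\<in>P. (v, a) \<in> E \<longrightarrow> (v, b) \<in> E \<longrightarrow> a = b"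
  shows "Poly_Mapping.keys a \<subseteq> V \<Longrightarrow> mon a c \<in> cycles \<Longrightarrow> mon a c \<in> gen"
proof (induction "card (Poly_Mapping.keys a)" arbitrary: a c rule: less_induct)
  case less
  let ?P = "Poly_Mapping.keys a"
  note a = less.prems(1)
  have finP: "finite S" if "S \<subseteq> ?P" for S using finite_subset[OF that finite_keys] .
  have finV: "finite S" if "S \<subseteq> V" for S using finite_subset[OF that finite_V] .
  consider (empty) "?P = {}"
    | (boundary) v where "v \<in> ?P" "2 \<le> Poly_Mapping.lookup a v \<or> (\<forall>w\<in>?P. (v, w) \<notin> E)"
    | (leaf) v u where "a = ind ?P" "v \<in> ?P" "u \<in> ?P" "(v, u) \<in> E" "\<And>w. w \<in> ?P \<Longrightarrow> (v, w) \<in> E \<Longrightarrow> w = u"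
  proof (cases "?P = {} \<or> (\<exists>v\<in>?P. 2 \<le> Poly_Mapping.lookup a v)")
    case False
    then have "Poly_Mapping.lookup a w = (if w \<in> ?P then 1 else 0)" for w
      by (cases "w \<in> ?P") (force simp: in_keys_iff not_le less_Suc_eq numeral_2_eq_2)+
    then have "a = ind ?P" by (intro poly_mapping_eqI) (simp add: lookup_ind)
    moreover obtain v where "v \<in> ?P" "\<forall>x\<in>?P. \<forall>y\<in>?P. (v, x) \<in> E \<longrightarrow> (v, y) \<in> E \<longrightarrow> x = y"
      using leaf_ex[OF a] False by blast
    ultimately show ?thesis using boundary that(3) by blast
  qed (use empty boundary in blast)+
  then show ?case
  proof cases
    case empty
    then have "mon a c = (\<lambda>S. if S = {} then mpoly_const (c {}) else 0)"
      by (auto simp: mon_def mpoly_const_def ind_def)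
    then show ?thesis using gen.scalar by metis
  next
    case (boundary v)
    from clear_vertex[OF a boundary(1) less.prems(2)] obtain c' where c':
      "homologous (mon a c) (mon a c')"
      "\<And>S. S \<subseteq> ?P \<Longrightarrow> v \<notin> S \<Longrightarrow> c' S = 0"
      "\<And>S. S \<subseteq> ?P \<Longrightarrow> v \<in> S \<Longrightarrow> stable E (Poly_Mapping.keys (a - ind (S - {v}))) \<Longrightarrow> c' S = 0"
      by metis
    have "mon a c' S \<in> K" for S
    proof (cases "S \<subseteq> ?P \<and> stable E (Poly_Mapping.keys (a - ind S))")
      case True
      have "c' S = 0"
      proof (cases "v \<in> S")
        case v: True
        \<comment> \<open>Removing \<open>v\<close> from \<open>S\<close> raises only the exponent
          of \<open>v\<close>, so the support grows by at most \<open>v\<close>.\<close>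
        have sub: "Poly_Mapping.keys (a - ind (S - {v})) \<subseteq> insert v (Poly_Mapping.keys (a - ind S))"
          using True finP[of S] by (auto simp: in_keys_iff lookup_minus lookup_ind split: if_splits)
        \<comment> \<open>Either \<open>v\<close> is in the support already, its exponent being at
          least 2, or it has no neighbours in \<open>P\<close>. In both cases independence survives,
          and the cycle condition at \<open>S - {v}\<close> applies.\<close>
        have "stable E (insert v (Poly_Mapping.keys (a - ind S)))"
        proof (cases "2 \<le> Poly_Mapping.lookup a v")
          case two: True
          then have "v \<in> Poly_Mapping.keys (a - ind S)"
            using True finP[of S] by (auto simp: in_keys_iff lookup_minus lookup_ind)
          then show ?thesis using True by (simp add: insert_absorb)
        next
          case False
          then have "\<forall>w\<in>?P. (v, w) \<notin> E" using boundary(2) by blast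
          moreover from this have "\<forall>w\<in>?P. (w, v) \<notin> E" using sym_E by (meson symD)
          ultimately show ?thesis
            using True keys_diff_subset[of a "ind S"] irrefl_E by (auto simp: stable_def)
        qed
        with sub have "stable E (Poly_Mapping.keys (a - ind (S - {v})))" by (auto simp: stable_def)
        then show ?thesis using c'(3) True v by blast
      qed (use c'(2) True in blast)
      then show ?thesis by (simp add: mon_def zero_K)
    next
      case False
      have "Poly_Mapping.keys (a - ind S) \<subseteq> V" using a keys_diff_subset[of a "ind S"] by auto
      then show ?thesis using False by (auto simp: mon_def zero_K single_K_iff)
    qed
    then have "mon a c' \<in> gen" by (intro gen_K) (simp add: cochains_def)
    then show ?thesis using c'(1) by (rule gen.homologous[OF _ cochains_mon[OF a]])
  next
    case (leaf v u)
    from clear_vertex[OF a leaf(2) less.prems(2)] obtain c' where c':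
      "homologous (mon a c) (mon a c')" "mon a c' \<in> cycles"
      "\<And>S. S \<subseteq> ?P \<Longrightarrow> v \<notin> S \<Longrightarrow> c' S = 0"
      "\<And>S. S \<subseteq> ?P \<Longrightarrow> v \<in> S \<Longrightarrow> stable E (Poly_Mapping.keys (a - ind (S - {v}))) \<Longrightarrow> c' S = 0"
      by metis
    \<comment> \<open>Since \<open>a\<close> is squarefree, subtracting \<open>S\<close> removes it
      from the support entirely.\<close>
    have keys: "Poly_Mapping.keys (a - ind S) = ?P - S" if "S \<subseteq> ?P" for S
      using finP[OF that] by (subst (1) leaf(1)) (auto simp: in_keys_iff[of _ "_ - _"] lookup_minus lookup_ind split: if_splits)
    define N where "N = {w \<in> ?P. (u, w) \<in> E}"
    define P' where "P' = ?P - insert u N"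
    \<comment> \<open>The cofactor after division by \<open>x_u dx_N\<close>. Its sign is the one
      that the product with \<open>dx_N\<close> produces at \<open>N \<union> S\<close>, so the two
      cancel.\<close>
    define z where "z = mon (ind P') (\<lambda>S. (-1) ^ inversions N S * c' (N \<union> S))"
    have N: "N \<subseteq> ?P" "N \<subseteq> V" "u \<notin> N" "v \<in> N" and "u \<in> V" and P': "P' \<subseteq> ?P" "P' \<subseteq> V" "N \<inter> P' = {}" "u \<notin> P'"
      using a leaf(2,3,4) sym_E irrefl_E by (auto simp: N_def P'_def dest: symD)
    have keysP': "Poly_Mapping.keys (ind P') = P'" using finP P' by (simp add: keys_ind)
    have z: "z \<in> cochains Q" unfolding z_def using P' by (intro cochains_mon) (simp add: keysP')
    have e: "star u N \<in> cycles" "star u N \<in> gen"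
      using \<open>u \<in> V\<close> N by (auto intro!: cycles_star gen.star simp: N_def)
    have split: "mon a c' S - wedge (star u N) z S \<in> K" if S: "S \<subseteq> V" for S
    proof (cases "N \<subseteq> S \<and> S - N \<subseteq> P'")
      case True
      then have SP: "S \<subseteq> ?P" "N \<subseteq> S" "u \<notin> S" using N P' by (auto simp: P'_def)
      \<comment> \<open>As \<open>S\<close> contains \<open>N\<close> and misses \<open>u\<close>,
        the complement of \<open>S\<close> in \<open>P\<close> is \<open>u\<close> together with the
        part of \<open>P'\<close> outside \<open>S\<close>.\<close>
      have exp: "Poly_Mapping.single u 1 + (ind P' - ind (S - N)) = a - ind S"
      proof (rule poly_mapping_eqI)
        fix w
        have "Poly_Mapping.lookup a w = (if w \<in> ?P then 1 else 0)"
          by (subst leaf(1)) (simp add: lookup_ind)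
        moreover have "finite P'" "finite S" "finite (S - N)" using finP P' finV S by auto
        ultimately show "Poly_Mapping.lookup (Poly_Mapping.single u 1 + (ind P' - ind (S - N))) w =
          Poly_Mapping.lookup (a - ind S) w"
          using SP True leaf(3) unfolding lookup_add lookup_minus
          by (auto simp: lookup_single when_def lookup_ind P'_def)
      qed
      have NS: "N \<union> (S - N) = S" using SP by auto
      have "wedge (star u N) z S = (-1) ^ inversions N (S - N) * (mpoly_var u * z (S - N))"
        unfolding star_def using SP by (simp add: wedge_single finV[OF S])
      also have "z (S - N) = Poly_Mapping.single (ind P' - ind (S - N)) ((-1) ^ inversions N (S - N) * c' S)"
        unfolding z_def mon_def keysP' NS using True by simp
      also have "(-1) ^ inversions N (S - N) * (mpoly_var u * \<dots>) = mon a c' S"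
        unfolding mpoly_var_def mult_single exp sign_single using SP
        by (simp add: mon_def mult.assoc[symmetric] power_add[symmetric] mult_2[symmetric])
      finally show ?thesis by (simp add: zero_K)
    next
      case False
      then have "wedge (star u N) z S = 0"
        unfolding star_def z_def by (auto simp: wedge_single finV[OF S] mon_def keysP')
      moreover have "mon a c' S \<in> K"
      proof (cases "S \<subseteq> ?P \<and> stable E (?P - S)")
        case True
        \<comment> \<open>A nonzero coefficient means that adding \<open>v\<close> to the
          independent set \<open>P - S\<close> creates an edge. Its other end can only be
          \<open>u\<close>, so \<open>u\<close> is outside \<open>S\<close>; independence of
          \<open>P - S\<close> then puts all of \<open>N\<close> into \<open>S\<close>, against the
          case assumption.\<close>
        have "c' S = 0"
        proof (rule ccontr)
          assume "c' S \<noteq> 0"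
          then have "v \<in> S" using c'(3) True by blast
          have "Poly_Mapping.keys (a - ind (S - {v})) = ?P - (S - {v})"
            using True by (intro keys) auto
          with \<open>v \<in> S\<close> \<open>c' S \<noteq> 0\<close> c'(4)[of S] True have "\<not> stable E (?P - (S - {v}))"
            by metis
          moreover have "?P - (S - {v}) = insert v (?P - S)" using leaf(2) by auto
          ultimately obtain w where w: "w \<in> ?P - S" "(v, w) \<in> E"
            using True irrefl_E sym_E by (auto simp: stable_def dest: symD)
          then have "u \<in> ?P - S" using leaf(5) by blast
          moreover from this have "N \<subseteq> S" using True by (auto simp: N_def stable_def)
          ultimately show False using False True by (auto simp: P'_def)
        qed
        then show ?thesis by (simp add: mon_def zero_K)
      next
        case False
        moreover have "Poly_Mapping.keys (a - ind S) \<subseteq> V" using a keys_diff_subset[of a "ind S"] by blast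
        ultimately show ?thesis by (auto simp: mon_def zero_K keys single_K_iff)
      qed
      ultimately show ?thesis by simp
    qed
    then have hom: "homologous (mon a c') (wedge (star u N) z)"
      by (intro homologous_K) (simp add: cochains_def)
    have "wedge (star u N) z \<in> cycles" using homologous_cycles[OF homologous_sym[OF hom] c'(2)] .
    then have wz: "kdiff V mpoly_var (wedge (star u N) z) U \<in> K" if "U \<subseteq> V" for U
      using that by (simp add: cycles_def cochains_def)
    have we: "wedge (kdiff V mpoly_var (star u N)) z U \<in> K" if "U \<subseteq> V" for U
      using cochains_wedge_K_left[OF _ z] e(1) that by (simp add: cycles_def cochains_def)
    \<comment> \<open>To show that the cofactor is a cycle, the Leibniz rule is solved for the
      product of the star with \<open>dz\<close>: the other two terms have coefficients in
      \<open>K\<close> by \<open>wz\<close> and \<open>we\<close>.\<close>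
    have "kdiff V mpoly_var z U \<in> K" if U: "U \<subseteq> V" for U
    proof (cases "U \<subseteq> P'")
      case True
      let ?d = "kdiff P' (\<lambda>_. 1) (\<lambda>S. (-1) ^ inversions N S * c' (N \<union> S)) U"
      let ?m = "ind P' - ind U"
      have dz: "kdiff V mpoly_var z U = Poly_Mapping.single ?m ?d"
        unfolding z_def using True P' by (subst kdiff_mon[OF finite_V _ U]) (auto simp: keysP' mon_def)
      have keysm: "Poly_Mapping.keys ?m \<subseteq> P'" using keys_diff_subset[of "ind P'" "ind U"] keysP' by simp
      let ?W = "N \<union> U"
      have W: "?W \<subseteq> V" "?W - N = U" using N U True P' by auto
      have sg: "(\<lambda>S. (-1) ^ card S * star u N S) = (\<lambda>S. if S = N then (-1) ^ card N * mpoly_var u else 0)"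
        by (auto simp: star_def)
      \<comment> \<open>At \<open>N \<union> U\<close> only the index \<open>N\<close> of the star
        contributes, so this coefficient is \<open>x_u\<close> times the coefficient of
        \<open>dz\<close> at \<open>U\<close>, up to sign.\<close>
      have "wedge (\<lambda>S. (-1) ^ card S * star u N S) (kdiff V mpoly_var z) ?W \<in> K"
        using diff_K[OF wz[OF W(1)] we[OF W(1)]] by (simp add: kdiff_wedge_V[OF W(1)])
      then have "(-1) ^ inversions N U * ((-1) ^ card N * mpoly_var u * Poly_Mapping.single ?m ?d) \<in> K"
        unfolding sg wedge_single[OF finV[OF W(1)]] W(2) dz by simp
      from mult_K[OF sign_Q[of "inversions N U + card N"] this]
      have "mpoly_var u * Poly_Mapping.single ?m ?d \<in> K"
        by (cases "even (inversions N U)"; cases "even (card N)") (auto dest: uminus_K)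
      then have "?d = 0 \<or> \<not> stable E (insert u (Poly_Mapping.keys ?m))"
        unfolding mpoly_var_def mult_single using \<open>u \<in> V\<close> keysm P'(2)
        by (subst (asm) single_K_iff) (auto simp: keys_add_nat)
      \<comment> \<open>Cancellation of \<open>x_u\<close>: as \<open>P'\<close> contains no
        neighbour of \<open>u\<close>, adding \<open>u\<close> to an independent subset of
        \<open>P'\<close> keeps it independent.\<close>
      moreover have "stable E (insert u (Poly_Mapping.keys ?m))" if "stable E (Poly_Mapping.keys ?m)"
        using that keysm irrefl_E sym_E by (auto simp: stable_def P'_def N_def dest: symD)
      ultimately show ?thesis unfolding dz using keysm P'(2) by (subst single_K_iff) auto
    next
      case False
      then show ?thesis
        unfolding z_def using P' by (subst kdiff_mon[OF finite_V _ U]) (auto simp: keysP' mon_def zero_K)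
    qed
    then have "z \<in> cycles" using z by (auto simp: cycles_def cochains_def)
    moreover have "card P' < card ?P"
      using leaf(3) P' by (intro psubset_card_mono) auto
    ultimately have "z \<in> gen"
      using less.hyps[of "ind P'"] P'(2) unfolding z_def keysP' by blast
    with e(2) have "wedge (star u N) z \<in> gen" by (rule gen.wedge)
    then show ?thesis
      using homologous_trans[OF c'(1) hom] by (rule gen.homologous[OF _ cochains_mon[OF a]])
  qed
qed

text \<open>The differential preserves multidegrees and \<open>K\<close> is spanned by monomials, so
  every multigraded component of a cycle modulo \<open>K\<close> is again such a cycle.\<close>

lemma gen_eq_cycles:
  assumes leaf_ex: "\<And>P. P \<subseteq> V \<Longrightarrow> P \<noteq> {} \<Longrightarrow> \<exists>v\<in>P. \<forall>a\<in>P. \<forall>b\<in>P. (v, a) \<in> E \<longrightarrow> (v, b) \<in> E \<longrightarrow> a = b"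
  shows "gen = cycles"
proof (intro equalityI subsetI gen_cycles)
  fix f assume f: "f \<in> cycles"
  \<comment> \<open>The term \<open>x^m dx_S\<close> has multidegree \<open>m + ind S\<close>, so
    multidegree \<open>a\<close> is read off at \<open>a - ind S\<close>. Values at sets outside the
    support of \<open>a\<close> are discarded by \<open>mon\<close>.\<close>
  define coef where "coef a g S = Poly_Mapping.lookup (g S) (a - ind S)"
    for a and g :: "'v set \<Rightarrow> ('v, 'k) mpoly" and S
  \<comment> \<open>The finitely many multidegrees that occur in \<open>f\<close>.\<close>
  define A where "A = (\<Union>S\<in>Pow V. (\<lambda>m. m + ind S) ` Poly_Mapping.keys (f S))"
  have finA: "finite A" using finite_V by (simp add: A_def)
  have fin: "finite S" if "S \<subseteq> V" for S using finite_subset[OF that finite_V] .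
  have keysA: "Poly_Mapping.keys a \<subseteq> V" if "a \<in> A" for a
  proof -
    from that obtain S m where S: "S \<subseteq> V" "m \<in> Poly_Mapping.keys (f S)" "a = m + ind S"
      by (auto simp: A_def)
    moreover have "f S \<in> Q" using cycles_cochains[OF f] S(1) by (simp add: cochains_def)
    then have "Poly_Mapping.keys m \<subseteq> V" using S(2) by (simp add: carrier_mpoly_ring)
    ultimately show ?thesis by (simp add: keys_add_nat keys_ind fin)
  qed
  have sum_mon: "f S = (\<Sum>a\<in>A. mon a (coef a f) S)" if S: "S \<subseteq> V" for S
  proof -
    have inj: "inj_on (\<lambda>m. m + ind S) (Poly_Mapping.keys (f S))" by (simp add: inj_on_def)
    have "mon a (coef a f) S = 0" if a: "a \<in> A - (\<lambda>m. m + ind S) ` Poly_Mapping.keys (f S)" for a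
    proof (cases "S \<subseteq> Poly_Mapping.keys a")
      case True
      then have "a - ind S + ind S = a"
        using fin[OF S] by (intro poly_mapping_eqI) (auto simp: lookup_add lookup_minus lookup_ind in_keys_iff)
      with a have "a - ind S \<notin> Poly_Mapping.keys (f S)" by (metis DiffD2 image_eqI)
      then show ?thesis by (simp add: mon_def coef_def in_keys_iff)
    qed (simp add: mon_def)
    then have "(\<Sum>a\<in>A. mon a (coef a f) S) = (\<Sum>a\<in>(\<lambda>m. m + ind S) ` Poly_Mapping.keys (f S). mon a (coef a f) S)"
      using finA S by (intro sum.mono_neutral_right) (auto simp: A_def)
    also have "\<dots> = (\<Sum>m\<in>Poly_Mapping.keys (f S). Poly_Mapping.single m (Poly_Mapping.lookup (f S) m))"
      unfolding sum.reindex[OF inj]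
      by (intro sum.cong) (auto simp: mon_def coef_def keys_add_nat keys_ind fin[OF S])
    finally show ?thesis by (simp only: poly_mapping_sum_singles[symmetric])
  qed
  have "mon a (coef a f) \<in> gen" if "a \<in> A" for a
  proof (rule gen_mon[OF leaf_ex keysA[OF that]])
    have "kdiff V mpoly_var (mon a (coef a f)) U \<in> K" if U: "U \<subseteq> V" for U
    proof (cases "U \<subseteq> Poly_Mapping.keys a")
      case True
      let ?n = "a - ind U"
      \<comment> \<open>Subtracting \<open>U\<close> leaves the exponent of \<open>v\<close>
        unchanged, so in this coefficient of \<open>df\<close> only the vertices in the support of
        \<open>a\<close> contribute.\<close>
      have n: "v \<in> Poly_Mapping.keys ?n \<longleftrightarrow> v \<in> Poly_Mapping.keys a" if "v \<notin> U" for v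
        using that fin[OF U] by (simp add: in_keys_iff lookup_minus lookup_ind)
      have "Poly_Mapping.lookup (kdiff V mpoly_var f U) ?n =
        (\<Sum>v\<in>V - U. (-1) ^ card {s\<in>U. s < v} * Poly_Mapping.lookup (mpoly_var v * f (insert v U)) ?n)"
        by (simp add: kdiff_def lookup_sum lookup_sign_mult)
      also have "\<dots> = (\<Sum>v\<in>Poly_Mapping.keys a - U.
         (-1) ^ card {s\<in>U. s < v} * Poly_Mapping.lookup (mpoly_var v * f (insert v U)) ?n)"
        using finite_V keysA[OF \<open>a \<in> A\<close>] n
        by (intro sum.mono_neutral_right) (auto simp: lookup_var_mult)
      also have "\<dots> = kdiff (Poly_Mapping.keys a) (\<lambda>_. 1) (coef a f) U"
        unfolding kdiff_def
        by (intro sum.cong refl)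
          (simp add: lookup_var_mult n coef_def single_add_diff_ind_insert(2)[OF fin[OF U]]
            flip: One_nat_def)
      finally have "kdiff V mpoly_var (mon a (coef a f)) U =
          Poly_Mapping.single ?n (Poly_Mapping.lookup (kdiff V mpoly_var f U) ?n)"
        using True by (simp add: kdiff_mon[OF finite_V keysA[OF \<open>a \<in> A\<close>] U] mon_def)
      moreover have "kdiff V mpoly_var f U \<in> K" using f U by (simp add: cycles_def cochains_def)
      then have "Poly_Mapping.lookup (kdiff V mpoly_var f U) ?n = 0 \<or> \<not> stable E (Poly_Mapping.keys ?n)"
        unfolding K_eq by (auto simp: in_keys_iff)
      moreover have "Poly_Mapping.keys ?n \<subseteq> V"
        using keys_diff_subset[of a "ind U"] keysA[OF \<open>a \<in> A\<close>] by blast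
      ultimately show ?thesis by (simp add: single_K_iff)
    next
      case False
      then show ?thesis by (simp add: kdiff_mon[OF finite_V keysA[OF \<open>a \<in> A\<close>] U] mon_def zero_K)
    qed
    then show "mon a (coef a f) \<in> cycles"
      using cochains_mon[OF keysA[OF that]] by (simp add: cycles_def cochains_def)
  qed blast+
  then have "(\<lambda>S. \<Sum>a\<in>A. mon a (coef a f) S) \<in> gen" by (rule gen_sum)
  \<comment> \<open>The sum of the components equals \<open>f\<close> only on subsets of
    \<open>V\<close>, so the two forms are compared by \<open>homologous\<close> instead of
    equality.\<close>
  then show "f \<in> gen"
    by (rule gen.homologous[OF _ cycles_cochains[OF f]])
      (intro homologous_K, simp add: cochains_def zero_K flip: sum_mon)
qed

text \<open>Rule induction over \<open>gen\<close> carries each of its clauses to a closure property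
  of the generated subring. The set \<open>X\<close> is left open, so that it can contain more than
  the scalars and the stars.\<close>

lemma generate_ring_H:
  assumes "\<And>P. P \<subseteq> V \<Longrightarrow> P \<noteq> {} \<Longrightarrow> \<exists>v\<in>P. \<forall>a\<in>P. \<forall>b\<in>P. (v, a) \<in> E \<longrightarrow> (v, b) \<in> E \<longrightarrow> a = b"
    and X: "X \<subseteq> carrier H"
    and scalar: "\<And>c. cl (\<lambda>S. if S = {} then mpoly_const c else 0) \<in> X"
    and star: "\<And>u N. u \<in> V \<Longrightarrow> N \<subseteq> V \<Longrightarrow> star u N \<in> cycles \<Longrightarrow> cl (star u N) \<in> X"
  shows "generate_ring H X = carrier H"
proof
  have "cl f \<in> generate_ring H X" if "f \<in> gen" for f
    using that
  proof (induction rule: gen.induct)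
    case (scalar c)
    then show ?case by (intro generate_ring.incl assms)
  next
    case (star u N)
    then show ?case by (intro generate_ring.incl assms cycles_star)
  next
    case (add f g)
    then show ?case using generate_ring.eng_add[of "cl f" H X "cl g"] by (simp add: H_add gen_cycles)
  next
    case (wedge f g)
    then show ?case using generate_ring.eng_mult[of "cl f" H X "cl g"] by (simp add: H_mult gen_cycles)
  next
    case (homologous f g)
    then have "cl g = cl f" using cl_cong[OF _ cycles_cochains[OF gen_cycles]] by blast
    with homologous show ?case by simp
  qed
  then show "carrier H \<subseteq> generate_ring H X"
    using gen_eq_cycles[OF assms(1)] by (auto simp: carrier_H)
  interpret H: abelian_group H by (rule abelian_group_H)
  show "generate_ring H X \<subseteq> carrier H"
  proof
    fix a assume "a \<in> generate_ring H X"
    then show "a \<in> carrier H"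
    proof induction
      case one
      have "(\<lambda>S. if S = {} then 1 else 0) \<in> cycles"
        using gen_cycles[OF gen.scalar[of 1]] by (simp add: mpoly_const_def cong: if_cong)
      moreover have "\<one>\<^bsub>H\<^esub> = cl (\<lambda>S. if S = {} then 1 else 0)"
        by (auto simp: koszul_homology_def FactRing_def cl_def koszul_class_def koszul_cycle_ring_def
            ext_algebra_def ext_const_def proj_def h_one h_zero if_distrib cong: if_cong)
      ultimately show ?case by (simp add: carrier_H)
    next
      case (eng_mult a b)
      then show ?case by (auto simp: carrier_H H_mult cycles_wedge)
    qed (use X in auto)
  qed
qed

end


section \<open>Generation of the Koszul homology by the linear strand\<close>

theorem corollary4p3:
  fixes G :: "'v::linorder pair_pre_digraph"
  assumes "pair_graph G" and "forest_graph G"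
  shows "generated_as_algebra
           (edge_homology_scalar G :: 'k::field \<Rightarrow> ('v, 'k) edge_homology)
           (edge_homology G)
           (sum_of_subgroups (edge_homology G) (\<lambda>i::nat. edge_homology_part G i (i + 1)))"
proof -
  interpret G: pair_graph G by fact
  let ?R = "edge_ring G :: ('v, 'k) mpoly set ring"
  let ?h = "edge_ring_class G :: ('v, 'k) mpoly \<Rightarrow> _"
  let ?V = "pverts G"
  interpret koszul_presentation ?R "carrier (mpoly_ring ?V)" ?h ?V mpoly_var
    by (rule koszul_presentation_edge_ring) fact
  interpret edge_koszul ?R ?h ?V "parcs G"
  proof
    show "K = {p \<in> carrier (mpoly_ring ?V). \<forall>m\<in>Poly_Mapping.keys p. \<not> stable (parcs G) (Poly_Mapping.keys m)}"
      by (simp add: koszul_presentation_K_edge_ring[OF assms(1)] edge_ideal_eq(1)[OF assms(1)])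
    show "sym (parcs G)" using G.pair_sym_arcs by (simp add: symmetric_def)
    show "(v, v) \<notin> parcs G" for v using G.pair_no_loops by fastforce
  qed
  have H: "edge_homology G = H" by (simp add: edge_homology_def)
  let ?M = "\<lambda>i. edge_homology_part G i (i + 1) :: ('v, 'k) edge_homology set"
  interpret H: abelian_group H by (rule abelian_group_H)
  have part: "?M i \<subseteq> carrier H" for i
    by (auto simp: edge_homology_part_def koszul_homology_part_def koszul_cycles_eq carrier_H cl_def)
  have sums: "sum_of_subgroups H ?M \<subseteq> carrier H"
    using part by (auto simp: sum_of_subgroups_def intro!: H.finsum_closed)
  \<comment> \<open>A single homogeneous class is a sum over a one-element index set.\<close>
  have part_sums: "a \<in> sum_of_subgroups H ?M" if "a \<in> ?M i" for a i
  proof -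
    have "a \<in> carrier H" using that part by blast
    then have "(\<Oplus>\<^bsub>H\<^esub>i\<in>{i}. a) = a" by simp
    then show ?thesis using that unfolding sum_of_subgroups_def
      by (intro CollectI exI[of _ "{i}"] exI[of _ "\<lambda>_. a"]) auto
  qed
  have scalar: "edge_homology_scalar G c = cl (\<lambda>S. if S = {} then mpoly_const c else 0)" for c
    unfolding edge_homology_scalar_def cl_def
    by (intro arg_cong[where f = "koszul_class _ _ _"])
      (simp add: ext_const_def proj_def h_zero if_distrib[of ?h] cong: if_cong)
  \<comment> \<open>The variable \<open>x_u\<close> has degree 1, so \<open>x_u dx_N\<close> lies in
    the summand with index \<open>card N\<close>.\<close>
  have star: "cl (star u N) \<in> ?M (card N)" if "u \<in> ?V" "star u N \<in> cycles" for u N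
  proof -
    have "?h (mpoly_var u) \<in> edge_ring_part G 1"
      using mpoly_ring_closed(5)[OF that(1)]
      by (auto simp: edge_ring_part_def mpoly_part_def mpoly_var_def monom_degree_def)
    then have "proj (star u N) \<in> koszul_part ?R (edge_ring_part G) ?V (card N) (card N + 1)"
      using proj_closed[OF cycles_cochains[OF that(2)]]
      by (auto simp: koszul_part_def proj_def star_def h_zero)
    then show ?thesis
      using that(2)
      by (auto simp: edge_homology_part_def koszul_homology_part_def koszul_cycles_eq cl_def)
  qed
  have "generate_ring H (range (edge_homology_scalar G) \<union> sum_of_subgroups H ?M) = carrier H"
  proof (rule generate_ring_H)
    fix P assume "P \<subseteq> ?V" "P \<noteq> {}"
    from forest_graph_leaf[OF assms(2) this]
    show "\<exists>v\<in>P. \<forall>a\<in>P. \<forall>b\<in>P. (v, a) \<in> parcs G \<longrightarrow> (v, b) \<in> parcs G \<longrightarrow> a = b" by metis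
  next
    have "cl (\<lambda>S. if S = {} then mpoly_const c else 0) \<in> carrier H" for c
      using gen_cycles[OF gen.scalar] by (simp add: carrier_H)
    then show "range (edge_homology_scalar G) \<union> sum_of_subgroups H ?M \<subseteq> carrier H"
      using sums by (auto simp: scalar)
    show "cl (\<lambda>S. if S = {} then mpoly_const c else 0) \<in> range (edge_homology_scalar G) \<union> sum_of_subgroups H ?M" for c
      unfolding scalar[symmetric] by blast
  next
    fix u N assume "u \<in> ?V" "star u N \<in> cycles"
    then show "cl (star u N) \<in> range (edge_homology_scalar G) \<union> sum_of_subgroups H ?M"
      using part_sums star by blast
  qed
  with sums show ?thesis unfolding generated_as_algebra_def H by simp
qed

end
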